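(* Let $H$ be a nonzero separable complex Hilbert space, let $E$ be a Banach space of complex-valued functions on $\mathbb{R}^+$ satisfying (H1), (H2), (H3) (stated in the context), let $\overline{E}$ be the associated Banach space of $H$-valued functions, and let $\mathbf{S}=\mathbf{S}_1$ and $\mathbf{S}_{-1}$ be the translation operators on $\overline{E}$. Then $$\operatorname{spec}(\mathbf{S})\cap\bigl(\operatorname{spec}(\mathbf{S}_{-1})\bigr)^{-1}=\Bigl\{z\in\mathbb{C}:\ \frac{1}{\rho(\mathbf{S}_{-1})}\le|z|\le\rho(\mathbf{S})\Bigr\}.$$
   Context: $\mathbb{R}^+=[0,+\infty[$. $C_c^\infty(\mathbb{R}^+)$ is the space of $C^\infty$ functions on $\mathbb{R}$ with compact support contained in $]0,+\infty[$, regarded as functions on $\mathbb{R}^+$. Scalar translations: for $a\ge0$, $(S_af)(x)=f(x-a)$ for a.e. $x\ge a$ and $(S_af)(x)=0$ for $x\in[0,a[$; $(S_{-a}f)(x)=f(x+a)$ for a.e. $x\in\mathbb{R}^+$. Hypotheses on $E$: (H1) $C_c^\infty(\mathbb{R}^+)\subset E\subset L^1_{loc}(\mathbb{R}^+)$, the inclusions are continuous, and $C_c^\infty(\mathbb{R}^+)$ is dense in $E$. (H2) For every $x\in\mathbb{R}$, $S_xE\subset E$, and $\sup_{x\in K}\|S_x\|<+\infty$ for every compact $K\subset\mathbb{R}$. (H3) For every $a\in\mathbb{R}$ the operator $\Gamma_a$, $(\Gamma_af)(x)=e^{iax}f(x)$ a.e., is bounded on $E$, and $\sup_{a\in\mathbb{R}}\|\Gamma_a\|<+\infty$.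 $\overline{E}$ is the space of (measurable) functions $F:\mathbb{R}^+\to H$ such that $x\mapsto\|F(x)\|_H$ belongs to $E$, with norm $\|F\|_{\overline{E}}=\bigl\|\,\|F(\cdot)\|_H\bigr\|_E$; it is taken to be a Banach space. For $a>0$, $(\mathbf{S}_aF)(x)=F(x-a)$ a.e. on $[a,+\infty[$, $(\mathbf{S}_aF)(x)=0$ on $[0,a[$, and $(\mathbf{S}_{-a}F)(x)=F(x+a)$ a.e. on $\mathbb{R}^+$; these are bounded operators on $\overline{E}$. $\operatorname{spec}(A)$ and $\rho(A)$ are the spectrum and spectral radius of a bounded operator $A$. For $X\subset\mathbb{C}$, $X^{-1}=\{1/z:z\in X,\ z\neq0\}$. *)

theory Defs
  imports "HOL-Analysis.Analysis"
begin

section \<open>Complex Hilbert spaces\<close>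

text \<open>The last axiom makes the inner product positive definite and the norm the induced one.\<close>

class chilbert_space = banach +
  fixes scaleC :: "complex \<Rightarrow> 'a \<Rightarrow> 'a"  (infixr "*\<^sub>C" 75)
    and cinner :: "'a \<Rightarrow> 'a \<Rightarrow> complex"
  assumes scaleC_add_right: "c *\<^sub>C (x + y) = c *\<^sub>C x + c *\<^sub>C y"
    and scaleC_add_left: "(c + d) *\<^sub>C x = c *\<^sub>C x + d *\<^sub>C x"
    and scaleC_scaleC: "c *\<^sub>C d *\<^sub>C x = (c * d) *\<^sub>C x"
    and scaleC_of_real: "complex_of_real r *\<^sub>C x = r *\<^sub>R x"
    and cinner_commute: "cinner x y = cnj (cinner y x)"
    and cinner_add_left: "cinner (x + y) z = cinner x z + cinner y z"
    and cinner_scaleC_left: "cinner (c *\<^sub>C x) y = c * cinner x y"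
    and cinner_self: "cinner x x = complex_of_real ((norm x)\<^sup>2)"

instantiation complex :: chilbert_space
begin

definition scaleC_complex :: "complex \<Rightarrow> complex \<Rightarrow> complex"
  where "scaleC_complex c x = c * x"

definition cinner_complex :: "complex \<Rightarrow> complex \<Rightarrow> complex"
  where "cinner_complex x y = x * cnj y"

instance
proof
  fix c d x y z :: complex and r :: real
  show "c *\<^sub>C (x + y) = c *\<^sub>C x + c *\<^sub>C y" "(c + d) *\<^sub>C x = c *\<^sub>C x + d *\<^sub>C x"
    by (simp_all add: scaleC_complex_def distrib_left distrib_right)
  show "c *\<^sub>C d *\<^sub>C x = (c * d) *\<^sub>C x" "complex_of_real r *\<^sub>C x = r *\<^sub>R x"
    by (simp_all add: scaleC_complex_def mult.assoc scaleR_conv_of_real)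
  show "cinner x y = cnj (cinner y x)" "cinner (x + y) z = cinner x z + cinner y z"
    by (simp_all add: cinner_complex_def algebra_simps)
  show "cinner (c *\<^sub>C x) y = c * cinner x y"
    by (simp add: cinner_complex_def scaleC_complex_def mult.assoc)
  show "cinner x x = complex_of_real ((norm x)\<^sup>2)"
    unfolding cinner_complex_def by (rule complex_norm_square[symmetric])
qed

end

section \<open>Topologies generated by seminorms\<close>

definition seminorm_on :: "(real \<Rightarrow> complex) set \<Rightarrow> ((real \<Rightarrow> complex) \<Rightarrow> real) \<Rightarrow> bool"
  where "seminorm_on V p \<longleftrightarrow>
    (\<forall>f\<in>V. p f \<ge> 0) \<and>
    (\<forall>f\<in>V. \<forall>g\<in>V. p (\<lambda>x. f x + g x) \<le> p f + p g) \<and>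
    (\<forall>f\<in>V. \<forall>c. p (\<lambda>x. c * f x) = cmod c * p f)"

definition seminorm_topology ::
    "(real \<Rightarrow> complex) set \<Rightarrow> ((real \<Rightarrow> complex) \<Rightarrow> real) set \<Rightarrow> (real \<Rightarrow> complex) topology"
  where "seminorm_topology V P = topology (\<lambda>U. U \<subseteq> V \<and>
    (\<forall>f\<in>U. \<exists>Q \<epsilon>. finite Q \<and> Q \<subseteq> P \<and> \<epsilon> > 0 \<and>
      (\<forall>g\<in>V. (\<forall>p\<in>Q. p (\<lambda>x. g x - f x) < \<epsilon>) \<longrightarrow> g \<in> U)))"

lemma openin_seminorm_topology:
  "openin (seminorm_topology V P) U \<longleftrightarrow> U \<subseteq> V \<and>
    (\<forall>f\<in>U. \<exists>Q \<epsilon>. finite Q \<and> Q \<subseteq> P \<and> \<epsilon> > 0 \<and>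
      (\<forall>g\<in>V. (\<forall>p\<in>Q. p (\<lambda>x. g x - f x) < \<epsilon>) \<longrightarrow> g \<in> U))"
proof -
  define nb where "nb U f \<longleftrightarrow> (\<exists>Q \<epsilon>. finite Q \<and> Q \<subseteq> P \<and> \<epsilon> > 0 \<and>
      (\<forall>g\<in>V. (\<forall>p\<in>Q. p (\<lambda>x. g x - f x) < \<epsilon>) \<longrightarrow> g \<in> U))" for U f
  have mono: "nb U' f" if "nb U f" "U \<subseteq> U'" for U U' f
  proof -
    obtain Q \<epsilon> where Q: "finite Q" "Q \<subseteq> P" "\<epsilon> > 0"
      "\<forall>g\<in>V. (\<forall>p\<in>Q. p (\<lambda>x. g x - f x) < \<epsilon>) \<longrightarrow> g \<in> U"
      using \<open>nb U f\<close> unfolding nb_def by blast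
    show ?thesis
      unfolding nb_def
      by (rule exI[of _ Q], rule exI[of _ \<epsilon>]) (use Q \<open>U \<subseteq> U'\<close> in blast)
  qed
  have int: "nb (U \<inter> U') f" if "nb U f" "nb U' f" for U U' f
  proof -
    obtain Q \<epsilon> where Q: "finite Q" "Q \<subseteq> P" "\<epsilon> > 0"
      "\<forall>g\<in>V. (\<forall>p\<in>Q. p (\<lambda>x. g x - f x) < \<epsilon>) \<longrightarrow> g \<in> U"
      using \<open>nb U f\<close> unfolding nb_def by blast
    obtain Q' \<epsilon>' where Q': "finite Q'" "Q' \<subseteq> P" "\<epsilon>' > 0"
      "\<forall>g\<in>V. (\<forall>p\<in>Q'. p (\<lambda>x. g x - f x) < \<epsilon>') \<longrightarrow> g \<in> U'"
      using \<open>nb U' f\<close> unfolding nb_def by blast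
    show ?thesis
      unfolding nb_def
      by (rule exI[of _ "Q \<union> Q'"], rule exI[of _ "min \<epsilon> \<epsilon>'"]) (use Q Q' in auto)
  qed
  have "istopology (\<lambda>U. U \<subseteq> V \<and> (\<forall>f\<in>U. nb U f))"
    unfolding istopology_def
  proof (intro conjI allI impI)
    fix K assume K: "\<forall>U\<in>K. U \<subseteq> V \<and> (\<forall>f\<in>U. nb U f)"
    show "\<Union>K \<subseteq> V" using K by blast
    show "\<forall>f\<in>\<Union>K. nb (\<Union>K) f"
    proof
      fix f assume "f \<in> \<Union>K"
      then obtain U where "U \<in> K" "f \<in> U" by blast
      then show "nb (\<Union>K) f" using K mono[of U f "\<Union>K"] by blast
    qed
  next
    fix U U' assume "U \<subseteq> V \<and> (\<forall>f\<in>U. nb U f)" "U' \<subseteq> V \<and> (\<forall>f\<in>U'. nb U' f)"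
    then show "U \<inter> U' \<subseteq> V" "\<forall>f\<in>U \<inter> U'. nb (U \<inter> U') f"
      using int by blast+
  qed
  then show ?thesis
    unfolding seminorm_topology_def nb_def by simp
qed

section \<open>Test functions and locally integrable functions\<close>

definition nth_deriv :: "nat \<Rightarrow> (real \<Rightarrow> complex) \<Rightarrow> real \<Rightarrow> complex"
  where "nth_deriv n = ((\<lambda>f x. vector_derivative f (at x)) ^^ n)"

definition smooth :: "(real \<Rightarrow> complex) \<Rightarrow> bool"
  where "smooth f \<longleftrightarrow> (\<forall>n x. nth_deriv n f differentiable (at x))"

definition fsupport :: "(real \<Rightarrow> complex) \<Rightarrow> real set"
  where "fsupport f = closure {x. f x \<noteq> 0}"

definition test_functions :: "(real \<Rightarrow> complex) set"
  where "test_functions = {f. smooth f \<and> compact (fsupport f) \<and> fsupport f \<subseteq> {0<..}}"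

definition test_functions_in :: "real set \<Rightarrow> (real \<Rightarrow> complex) set"
  where "test_functions_in K = {f \<in> test_functions. fsupport f \<subseteq> K}"

definition test_topology_in :: "real set \<Rightarrow> (real \<Rightarrow> complex) topology"
  where "test_topology_in K =
    seminorm_topology (test_functions_in K) (range (\<lambda>n f. SUP x. cmod (nth_deriv n f x)))"

text \<open>The inductive limit topology: the finest locally convex topology for which the inclusions
  of the Frechet spaces \<^term>\<open>test_functions_in K\<close> are continuous.\<close>

definition test_topology :: "(real \<Rightarrow> complex) topology"
  where "test_topology = seminorm_topology test_functions
    {p. seminorm_on test_functions p \<and>
        (\<forall>K. compact K \<and> K \<subseteq> {0<..} \<longrightarrow> continuous_map (test_topology_in K) euclideanreal p)}"

definition L1_loc :: "(real \<Rightarrow> complex) set"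
  where "L1_loc = {f. \<forall>K. compact K \<and> K \<subseteq> {0..} \<longrightarrow> f absolutely_integrable_on K}"

definition L1_loc_topology :: "(real \<Rightarrow> complex) topology"
  where "L1_loc_topology = seminorm_topology L1_loc
    {\<lambda>f. (LINT x:K|lebesgue. cmod (f x)) | K. compact K \<and> K \<subseteq> {0..}}"

section \<open>Banach spaces of functions on the half-line\<close>

text \<open>A space of functions on \<open>[0, \<infinity>)\<close> modulo equality almost everywhere is represented by the
  set of all representatives, as functions on \<^typ>\<open>real\<close> whose values at negative arguments are
  irrelevant, together with the norm as a function of the representative. Equality in the space is
  \<open>ae_eq\<close>.\<close>

definition ae_eq :: "(real \<Rightarrow> 'h) \<Rightarrow> (real \<Rightarrow> 'h) \<Rightarrow> bool"
  where "ae_eq f g \<longleftrightarrow> (AE x in lebesgue_on {0..}. f x = g x)"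

definition banach_function_space ::
    "(real \<Rightarrow> 'h::chilbert_space) set \<Rightarrow> ((real \<Rightarrow> 'h) \<Rightarrow> real) \<Rightarrow> bool"
  where "banach_function_space V N \<longleftrightarrow>
    V \<subseteq> borel_measurable (lebesgue_on {0..}) \<and>
    (\<forall>f\<in>V. \<forall>g. ae_eq f g \<longrightarrow> g \<in> V) \<and>
    (\<lambda>x. 0) \<in> V \<and>
    (\<forall>f\<in>V. \<forall>g\<in>V. (\<lambda>x. f x + g x) \<in> V) \<and>
    (\<forall>f\<in>V. \<forall>c. (\<lambda>x. c *\<^sub>C f x) \<in> V) \<and>
    (\<forall>f\<in>V. N f \<ge> 0) \<and>
    (\<forall>f\<in>V. N f = 0 \<longleftrightarrow> ae_eq f (\<lambda>x. 0)) \<and>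
    (\<forall>f\<in>V. \<forall>g\<in>V. N (\<lambda>x. f x + g x) \<le> N f + N g) \<and>
    (\<forall>f\<in>V. \<forall>c. N (\<lambda>x. c *\<^sub>C f x) = cmod c * N f) \<and>
    (\<forall>u. (\<forall>n. u n \<in> V) \<and>
         (\<forall>\<epsilon>>0. \<exists>n0. \<forall>m\<ge>n0. \<forall>n\<ge>n0. N (\<lambda>x. u m x - u n x) < \<epsilon>) \<longrightarrow>
         (\<exists>f\<in>V. (\<lambda>n::nat. N (\<lambda>x. u n x - f x)) \<longlonglongrightarrow> 0))"

definition op_norm ::
    "(real \<Rightarrow> 'h) set \<Rightarrow> ((real \<Rightarrow> 'h) \<Rightarrow> real) \<Rightarrow> ((real \<Rightarrow> 'h) \<Rightarrow> real \<Rightarrow> 'h) \<Rightarrow> ennreal"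
  where "op_norm V N A = (SUP f\<in>{f \<in> V. N f \<le> 1}. ennreal (N (A f)))"

definition bounded_operator ::
    "(real \<Rightarrow> 'h::chilbert_space) set \<Rightarrow> ((real \<Rightarrow> 'h) \<Rightarrow> real) \<Rightarrow>
     ((real \<Rightarrow> 'h) \<Rightarrow> real \<Rightarrow> 'h) \<Rightarrow> bool"
  where "bounded_operator V N A \<longleftrightarrow>
    A ` V \<subseteq> V \<and>
    (\<forall>f\<in>V. \<forall>g\<in>V. ae_eq (A (\<lambda>x. f x + g x)) (\<lambda>x. A f x + A g x)) \<and>
    (\<forall>f\<in>V. \<forall>c. ae_eq (A (\<lambda>x. c *\<^sub>C f x)) (\<lambda>x. c *\<^sub>C A f x)) \<and>
    op_norm V N A < \<infinity>"

definition op_spectrum ::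
    "(real \<Rightarrow> 'h::chilbert_space) set \<Rightarrow> ((real \<Rightarrow> 'h) \<Rightarrow> real) \<Rightarrow>
     ((real \<Rightarrow> 'h) \<Rightarrow> real \<Rightarrow> 'h) \<Rightarrow> complex set"
  where "op_spectrum V N A = {z. \<not> (\<exists>B. bounded_operator V N B \<and>
    (\<forall>f\<in>V. ae_eq (B (\<lambda>x. A f x - z *\<^sub>C f x)) f) \<and>
    (\<forall>f\<in>V. ae_eq (\<lambda>x. A (B f) x - z *\<^sub>C B f x) f))}"

definition op_spectral_radius ::
    "(real \<Rightarrow> 'h::chilbert_space) set \<Rightarrow> ((real \<Rightarrow> 'h) \<Rightarrow> real) \<Rightarrow>
     ((real \<Rightarrow> 'h) \<Rightarrow> real \<Rightarrow> 'h) \<Rightarrow> real"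
  where "op_spectral_radius V N A = (SUP z\<in>op_spectrum V N A. cmod z)"

section \<open>Translations, modulations and the hypotheses on the scalar space\<close>

text \<open>Extend \<open>f\<close> by \<open>0\<close> to the whole line, translate by \<open>a\<close> and restrict to \<open>[0, \<infinity>)\<close>; for
  \<open>a \<le> 0 \<le> x\<close> the condition \<open>0 \<le> x - a\<close> holds automatically.\<close>

definition translation :: "real \<Rightarrow> (real \<Rightarrow> 'h::zero) \<Rightarrow> real \<Rightarrow> 'h"
  where "translation a f = (\<lambda>x. if 0 \<le> x - a then f (x - a) else 0)"

definition modulation :: "real \<Rightarrow> (real \<Rightarrow> complex) \<Rightarrow> real \<Rightarrow> complex"
  where "modulation a f = (\<lambda>x. exp (\<i> * complex_of_real (a * x)) * f x)"

definition hyp_H1 :: "(real \<Rightarrow> complex) set \<Rightarrow> ((real \<Rightarrow> complex) \<Rightarrow> real) \<Rightarrow> bool"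
  where "hyp_H1 E N \<longleftrightarrow>
    test_functions \<subseteq> E \<and> E \<subseteq> L1_loc \<and>
    continuous_map test_topology (seminorm_topology E {N}) (\<lambda>f. f) \<and>
    continuous_map (seminorm_topology E {N}) L1_loc_topology (\<lambda>f. f) \<and>
    (seminorm_topology E {N}) closure_of test_functions = E"

definition hyp_H2 :: "(real \<Rightarrow> complex) set \<Rightarrow> ((real \<Rightarrow> complex) \<Rightarrow> real) \<Rightarrow> bool"
  where "hyp_H2 E N \<longleftrightarrow>
    (\<forall>a. translation a ` E \<subseteq> E) \<and>
    (\<forall>K. compact K \<longrightarrow> (SUP a\<in>K. op_norm E N (translation a)) < \<infinity>)"

definition hyp_H3 :: "(real \<Rightarrow> complex) set \<Rightarrow> ((real \<Rightarrow> complex) \<Rightarrow> real) \<Rightarrow> bool"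
  where "hyp_H3 E N \<longleftrightarrow>
    (\<forall>a. bounded_operator E N (modulation a)) \<and>
    (SUP a. op_norm E N (modulation a)) < \<infinity>"

section \<open>The associated space of vector-valued functions\<close>

definition vec_space :: "(real \<Rightarrow> complex) set \<Rightarrow> (real \<Rightarrow> 'h::chilbert_space) set"
  where "vec_space E =
    {F \<in> borel_measurable (lebesgue_on {0..}). (\<lambda>x. complex_of_real (norm (F x))) \<in> E}"

definition vec_norm :: "((real \<Rightarrow> complex) \<Rightarrow> real) \<Rightarrow> (real \<Rightarrow> 'h::chilbert_space) \<Rightarrow> real"
  where "vec_norm N F = N (\<lambda>x. complex_of_real (norm (F x)))"

end

theory Submission
  imports Defs
begin

text \<open>Both spectra are closed discs around \<open>0\<close>, which gives the theorem at once.
  Let \<open>A\<close> be one of \<open>S\<close>, \<open>S\<^sub>-\<^sub>1\<close> and let \<open>z\<close> lie outside its spectrum. The norm of \<open>\<^bold>E\<close>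
  only depends on the pointwise norm, so conjugation with \<open>e\<^sup>i\<^sup>\<theta>\<^sup>x\<close> shows that the whole circle of
  radius \<open>r = |z|\<close> lies in the resolvent set, with a uniform bound on the resolvent; moreover
  \<open>\<^bold>E\<close> is a Banach lattice for the pointwise norm. For \<open>f = |F|\<close> and the solution \<open>g\<close> of
  \<open>(r - A) g = f\<close> this yields \<open>A\<^sup>k f \<le> r\<^sup>k\<^sup>+\<^sup>1 g\<close>, hence \<open>\<parallel>A\<^sup>k\<parallel> \<le> C r\<^sup>k\<^sup>+\<^sup>1\<close>, and by the Neumann series
  everything outside the circle, and also a thin annulus inside it, belongs to the resolvent set.
  So the spectral radius is strictly smaller than \<open>|z|\<close>.
  For \<open>S\<^sub>-\<^sub>1\<close> positivity of \<open>g\<close> is clear only if \<open>f\<close> has compact support. Such functions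
  are dense: truncations of \<open>f\<close> are controlled by multipliers that are averages of modulations,
  which (H3) bounds on \<open>E\<close>, and test functions are dense in \<open>E\<close> by (H1).\<close>

subsection \<open>Complex scalars and almost everywhere equality\<close>

text \<open>Two obstacles shape the argument. In E a function h is controlled by |h|
  (\<open>E_solid_complex\<close>), but no hypothesis says that |h| lies in E when h does, let alone
  that h controls it. Density of test functions \<phi> is measured by the norm of f - \<phi>, while
  the vector norm is that of |F|, so the approximation error cannot simply be cut off. Multipliers
  have to be bounded on complex functions before any absolute value is taken, and combinations of
  modulations are what (H3) offers. A nonnegative trigonometric polynomial m can be small near 0 and
  at least 1/2 on a long interval; since m |F| is again nonnegative, solidity applies to it. The
  other obstacle is the direction of the recursion. In r g = f + S g each orbit has a first point,
  where S g = 0. In r g = f + S_{-1} g it runs to the right without a last point, and geometric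
  sequences g (x + j) = c r^j solve the homogeneous equation. For f of compact support, injectivity
  of r - S_{-1}, applied to a translate of g, excludes them.\<close>

lemma norm_scaleC [simp]: "norm (c *\<^sub>C x) = cmod c * norm (x::'h::chilbert_space)"
proof -
  have "complex_of_real ((norm (c *\<^sub>C x))\<^sup>2) = c * (cnj c * cinner x x)"
    by (metis cinner_commute cinner_scaleC_left cinner_self complex_cnj_mult)
  also have "\<dots> = complex_of_real ((cmod c * norm x)\<^sup>2)"
    unfolding cinner_self power_mult_distrib of_real_mult complex_norm_square by (simp only: ac_simps)
  finally show ?thesis
    by (smt (verit) of_real_eq_iff mult_nonneg_nonneg norm_ge_zero power2_eq_iff_nonneg)
qed

lemma scaleC_one [simp]: "1 *\<^sub>C x = (x::'h::chilbert_space)"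
  using scaleC_of_real[of 1 x] by simp

lemma scaleC_zero [simp]: "0 *\<^sub>C x = (0::'h::chilbert_space)"
  using scaleC_of_real[of 0 x] by simp

lemma scaleC_zero_right [simp]: "c *\<^sub>C 0 = (0::'h::chilbert_space)"
  by (metis norm_scaleC norm_zero mult_zero_right norm_eq_zero)

lemma scaleC_minus_left: "(- c) *\<^sub>C x = - (c *\<^sub>C (x::'h::chilbert_space))"
  by (metis add.left_inverse add_eq_0_iff2 scaleC_add_left scaleC_zero)

lemma scaleC_minus_right: "c *\<^sub>C (- x) = - (c *\<^sub>C (x::'h::chilbert_space))"
  by (metis add.left_inverse add_eq_0_iff2 scaleC_add_right scaleC_zero_right)

lemma scaleC_diff_right: "c *\<^sub>C (x - y) = c *\<^sub>C x - c *\<^sub>C (y::'h::chilbert_space)"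
  using scaleC_add_right[of c x "- y"] by (simp add: scaleC_minus_right)

lemma scaleC_diff_left: "(c - d) *\<^sub>C x = c *\<^sub>C x - d *\<^sub>C (x::'h::chilbert_space)"
  using scaleC_add_left[of c "- d" x] by (simp add: scaleC_minus_left)

lemma scaleC_left_commute: "c *\<^sub>C d *\<^sub>C x = d *\<^sub>C c *\<^sub>C (x::'h::chilbert_space)"
  by (simp add: scaleC_scaleC mult.commute)

lemma ae_eq_refl [simp]: "ae_eq f f"
  by (simp add: ae_eq_def)

lemma ae_eq_sym: "ae_eq f g \<Longrightarrow> ae_eq g f"
  unfolding ae_eq_def by (auto elim: eventually_mono)

lemma ae_eq_trans [trans]: "ae_eq f g \<Longrightarrow> ae_eq g h \<Longrightarrow> ae_eq f h"
  unfolding ae_eq_def by (auto elim: eventually_elim2)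

lemma ae_eq_add:
  "ae_eq f f' \<Longrightarrow> ae_eq g g' \<Longrightarrow> ae_eq (\<lambda>x. f x + g x) (\<lambda>x. f' x + g' x)"
  unfolding ae_eq_def by (auto elim: eventually_elim2)

lemma ae_eq_diff:
  "ae_eq f f' \<Longrightarrow> ae_eq g g' \<Longrightarrow> ae_eq (\<lambda>x. f x - g x) (\<lambda>x. f' x - g' x)"
  unfolding ae_eq_def by (auto elim: eventually_elim2)

lemma ae_eq_scaleC: "ae_eq f f' \<Longrightarrow> ae_eq (\<lambda>x. c *\<^sub>C f x) (\<lambda>x. c *\<^sub>C f' x)"
  unfolding ae_eq_def by (auto elim: eventually_mono)

lemma ae_eq_diff_zero: "ae_eq (\<lambda>x. f x - g x) (\<lambda>x. 0) \<longleftrightarrow> ae_eq f (g :: real \<Rightarrow> 'h::real_normed_vector)"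
  by (simp add: ae_eq_def)

lemma AE_half_line_iff:
  "(AE x in lebesgue_on {0..}. P x) \<longleftrightarrow> (AE x in lebesgue. 0 \<le> x \<longrightarrow> P (x::real))"
  by (subst AE_restrict_space_iff) auto

lemma ae_eqI: "(\<And>x. 0 \<le> x \<Longrightarrow> f x = g x) \<Longrightarrow> ae_eq f g"
  by (simp add: ae_eq_def AE_half_line_iff)

subsection \<open>Resolvents in Banach function spaces\<close>

locale function_space =
  fixes V :: "(real \<Rightarrow> 'h::chilbert_space) set" and N :: "(real \<Rightarrow> 'h) \<Rightarrow> real"
  assumes banach: "banach_function_space V N"
begin

lemma measurable: "f \<in> V \<Longrightarrow> f \<in> borel_measurable (lebesgue_on {0..})"
  and ae_closed: "f \<in> V \<Longrightarrow> ae_eq f g \<Longrightarrow> g \<in> V"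
  and zero_mem [simp]: "(\<lambda>x. 0) \<in> V"
  and add_mem: "f \<in> V \<Longrightarrow> g \<in> V \<Longrightarrow> (\<lambda>x. f x + g x) \<in> V"
  and scaleC_mem: "f \<in> V \<Longrightarrow> (\<lambda>x. c *\<^sub>C f x) \<in> V"
  and N_nonneg: "f \<in> V \<Longrightarrow> 0 \<le> N f"
  and N_eq_0_iff: "f \<in> V \<Longrightarrow> N f = 0 \<longleftrightarrow> ae_eq f (\<lambda>x. 0)"
  and N_add: "f \<in> V \<Longrightarrow> g \<in> V \<Longrightarrow> N (\<lambda>x. f x + g x) \<le> N f + N g"
  and N_scaleC: "f \<in> V \<Longrightarrow> N (\<lambda>x. c *\<^sub>C f x) = cmod c * N f"
  using banach unfolding banach_function_space_def by blast+

lemma complete: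
  assumes "\<And>n. u n \<in> V"
    and "\<And>\<epsilon>. 0 < \<epsilon> \<Longrightarrow> \<exists>n0. \<forall>m\<ge>n0. \<forall>n\<ge>n0. N (\<lambda>x. u m x - u n x) < \<epsilon>"
  obtains f where "f \<in> V" "(\<lambda>n::nat. N (\<lambda>x. u n x - f x)) \<longlonglongrightarrow> 0"
  using banach assms unfolding banach_function_space_def by blast

lemma minus_mem: "f \<in> V \<Longrightarrow> (\<lambda>x. - f x) \<in> V"
  using scaleC_mem[of f "-1"] by (simp add: scaleC_minus_left)

lemma diff_mem: "f \<in> V \<Longrightarrow> g \<in> V \<Longrightarrow> (\<lambda>x. f x - g x) \<in> V"
  using add_mem[of f "\<lambda>x. - g x"] minus_mem by simp

lemma N_zero [simp]: "N (\<lambda>x. 0) = 0"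
  by (simp add: N_eq_0_iff)

lemma N_minus: "f \<in> V \<Longrightarrow> N (\<lambda>x. - f x) = N f"
  using N_scaleC[of f "-1"] by (simp add: scaleC_minus_left)

lemma N_diff: "f \<in> V \<Longrightarrow> g \<in> V \<Longrightarrow> N (\<lambda>x. f x - g x) \<le> N f + N g"
  using N_add[of f "\<lambda>x. - g x"] minus_mem N_minus by simp

lemma N_diff_commute: "f \<in> V \<Longrightarrow> g \<in> V \<Longrightarrow> N (\<lambda>x. f x - g x) = N (\<lambda>x. g x - f x)"
  using N_minus[OF diff_mem[of f g]] by simp

lemma N_triangle_diff:
  assumes "f \<in> V" "g \<in> V" "h \<in> V"
  shows "N (\<lambda>x. f x - h x) \<le> N (\<lambda>x. f x - g x) + N (\<lambda>x. g x - h x)"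
  using N_add[OF diff_mem diff_mem, of f g g h] assms by simp

lemma N_le_diff: "f \<in> V \<Longrightarrow> g \<in> V \<Longrightarrow> N f \<le> N g + N (\<lambda>x. f x - g x)"
  using N_add[OF _ diff_mem, of g f g] by simp

lemma N_diff_eq_0_iff: "f \<in> V \<Longrightarrow> g \<in> V \<Longrightarrow> N (\<lambda>x. f x - g x) = 0 \<longleftrightarrow> ae_eq f g"
  by (simp add: N_eq_0_iff diff_mem ae_eq_diff_zero)

lemma N_ae: assumes "f \<in> V" "ae_eq f g" shows "N g = N f"
proof -
  have g: "g \<in> V" using assms ae_closed by blast
  have "N (\<lambda>x. f x - g x) = 0" "N (\<lambda>x. g x - f x) = 0"
    using assms g N_diff_eq_0_iff ae_eq_sym by blast+
  then show ?thesis
    using N_le_diff[OF \<open>f \<in> V\<close> g] N_le_diff[OF g \<open>f \<in> V\<close>] by linarith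
qed

lemma N_le_0_imp: "f \<in> V \<Longrightarrow> N f \<le> 0 \<Longrightarrow> ae_eq f (\<lambda>x. 0)"
  using N_eq_0_iff N_nonneg by (metis order_antisym)

text \<open>Scaling reduces to the unit ball. If \<open>N f = 0\<close>, every multiple of
  \<open>f\<close> lies in that ball, so all multiples of \<open>A f\<close> are bounded by one
  constant, which forces \<open>N (A f) = 0\<close>.\<close>

lemma op_normD:
  assumes fin: "op_norm V N A < \<infinity>" and maps: "A ` V \<subseteq> V"
    and hom: "\<And>f c. f \<in> V \<Longrightarrow> ae_eq (A (\<lambda>x. c *\<^sub>C f x)) (\<lambda>x. c *\<^sub>C A f x)"
    and f: "f \<in> V"
  shows "N (A f) \<le> enn2real (op_norm V N A) * N f"
proof -
  let ?C = "enn2real (op_norm V N A)"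
  have unit: "N (A g) \<le> ?C" if "g \<in> V" "N g \<le> 1" for g
  proof -
    have "ennreal (N (A g)) \<le> op_norm V N A"
      unfolding op_norm_def using that by (intro SUP_upper) auto
    then have "enn2real (ennreal (N (A g))) \<le> ?C"
      using fin by (intro enn2real_mono) auto
    moreover have "0 \<le> N (A g)" using maps that N_nonneg by blast
    ultimately show ?thesis by simp
  qed
  have scaled: "cmod c * N (A f) \<le> ?C" if "cmod c * N f \<le> 1" for c
  proof -
    have "A f \<in> V" using maps f by blast
    have "N (A (\<lambda>x. c *\<^sub>C f x)) = cmod c * N (A f)"
      using N_ae[OF scaleC_mem[OF \<open>A f \<in> V\<close>] ae_eq_sym[OF hom[OF f]]] N_scaleC[OF \<open>A f \<in> V\<close>] by simp
    then show ?thesis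
      using unit[of "\<lambda>x. c *\<^sub>C f x"] that f by (simp add: scaleC_mem N_scaleC)
  qed
  show ?thesis
  proof (cases "N f = 0")
    case True
    have "N (A f) \<le> 0"
    proof (rule ccontr)
      assume "\<not> N (A f) \<le> 0"
      then have "((?C + 1) / N (A f)) * N (A f) \<le> ?C"
        using scaled[of "complex_of_real ((?C + 1) / N (A f))"] True
        by (simp add: norm_divide norm_of_real del: of_real_divide of_real_add)
      then show False using \<open>\<not> N (A f) \<le> 0\<close> by simp
    qed
    then show ?thesis using True by simp
  next
    case False
    then have "N f > 0" using N_nonneg[OF f] by simp
    then have "N (A f) / N f \<le> ?C"
      using scaled[of "complex_of_real (1 / N f)"] by (simp add: norm_divide)
    then show ?thesis using \<open>N f > 0\<close> by (simp add: field_simps)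
  qed
qed

section \<open>Linear operators modulo null sets\<close>

definition linear_op where
  "linear_op A \<longleftrightarrow> A ` V \<subseteq> V \<and>
    (\<forall>f\<in>V. \<forall>g\<in>V. ae_eq (A (\<lambda>x. f x + g x)) (\<lambda>x. A f x + A g x)) \<and>
    (\<forall>f\<in>V. \<forall>c. ae_eq (A (\<lambda>x. c *\<^sub>C f x)) (\<lambda>x. c *\<^sub>C A f x))"

text \<open>A real constant replaces the ennreal supremum \<open>op_norm\<close>, so that estimates
  are inequalities between reals. The next two lemmas pass between the two forms.\<close>

definition bounded_by where
  "bounded_by A C \<longleftrightarrow> linear_op A \<and> 0 \<le> C \<and> (\<forall>f\<in>V. N (A f) \<le> C * N f)"

lemma bounded_by_imp_bounded_operator:
  assumes "bounded_by A C"
  shows "bounded_operator V N A"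
proof -
  have "op_norm V N A \<le> ennreal C"
    unfolding op_norm_def
  proof (rule SUP_least)
    fix f assume "f \<in> {f \<in> V. N f \<le> 1}"
    then have "N (A f) \<le> C * N f" "N f \<le> 1" using assms by (auto simp: bounded_by_def)
    moreover have "C * N f \<le> C" using assms \<open>N f \<le> 1\<close> by (simp add: bounded_by_def mult_left_le)
    ultimately show "ennreal (N (A f)) \<le> ennreal C" by (simp add: ennreal_leI)
  qed
  then have "op_norm V N A < \<infinity>"
    using order_le_less_trans[of _ "ennreal C" \<infinity>] by simp
  then show ?thesis using assms by (simp add: bounded_operator_def bounded_by_def linear_op_def)
qed

lemma bounded_operator_imp_bounded_by:
  assumes "bounded_operator V N A"
  shows "bounded_by A (enn2real (op_norm V N A))"
  using assms op_normD[of A] unfolding bounded_operator_def bounded_by_def linear_op_def by auto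

context
  fixes A :: "(real \<Rightarrow> 'h) \<Rightarrow> real \<Rightarrow> 'h" and c :: real
  assumes A: "bounded_by A c"
begin

lemma op_mem: "f \<in> V \<Longrightarrow> A f \<in> V"
  and op_add: "f \<in> V \<Longrightarrow> g \<in> V \<Longrightarrow> ae_eq (A (\<lambda>x. f x + g x)) (\<lambda>x. A f x + A g x)"
  and op_scaleC: "f \<in> V \<Longrightarrow> ae_eq (A (\<lambda>x. d *\<^sub>C f x)) (\<lambda>x. d *\<^sub>C A f x)"
  and op_bound: "f \<in> V \<Longrightarrow> N (A f) \<le> c * N f"
  and op_bound_nonneg: "0 \<le> c"
  using A by (auto simp: bounded_by_def linear_op_def)

lemma op_diff:
  assumes "f \<in> V" "g \<in> V"
  shows "ae_eq (A (\<lambda>x. f x - g x)) (\<lambda>x. A f x - A g x)"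
proof -
  have "ae_eq (A (\<lambda>x. f x + (-1) *\<^sub>C g x)) (\<lambda>x. A f x + A (\<lambda>x. (-1) *\<^sub>C g x) x)"
    by (intro op_add assms scaleC_mem)
  also have "ae_eq \<dots> (\<lambda>x. A f x + (-1) *\<^sub>C A g x)"
    by (intro ae_eq_add ae_eq_diff ae_eq_scaleC op_scaleC assms ae_eq_refl)
  finally show ?thesis by (simp add: scaleC_minus_left)
qed

lemma op_diff_bound:
  assumes "f \<in> V" "g \<in> V"
  shows "N (\<lambda>x. A f x - A g x) \<le> c * N (\<lambda>x. f x - g x)"
  using N_ae[OF op_mem[OF diff_mem[OF assms]] op_diff[OF assms]] op_bound[OF diff_mem[OF assms]] by simp

text \<open>Operators act on representatives and respect null sets only as a consequence of
  boundedness: a function of norm 0 has an image of norm 0.\<close>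

lemma op_ae:
  assumes "f \<in> V" "ae_eq f g" shows "ae_eq (A f) (A g)"
proof -
  have g: "g \<in> V" using assms ae_closed by blast
  have "N (\<lambda>x. A f x - A g x) \<le> 0"
    using op_diff_bound[OF \<open>f \<in> V\<close> g] N_diff_eq_0_iff[OF \<open>f \<in> V\<close> g] assms by simp
  then show ?thesis
    using N_le_0_imp[OF diff_mem[OF op_mem op_mem], of f g] assms g ae_eq_diff_zero by blast
qed

lemma op_power_mem: "f \<in> V \<Longrightarrow> (A ^^ k) f \<in> V"
  by (induction k) (auto intro: op_mem)

lemma op_power_bound: assumes "f \<in> V" shows "N ((A ^^ k) f) \<le> c ^ k * N f"
proof (induction k)
  case (Suc k)
  have "N ((A ^^ Suc k) f) \<le> c * N ((A ^^ k) f)"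
    using op_bound[OF op_power_mem[OF assms]] by simp
  also have "\<dots> \<le> c * (c ^ k * N f)"
    using Suc op_bound_nonneg by (rule mult_left_mono)
  finally show ?case by (simp add: mult.assoc)
qed simp

end

section \<open>Resolvent sets through solvability with a bound\<close>

text \<open>Solvability with a bound, together with injectivity, replaces the inverse operator. No
  representative of a solution has to be fixed, and the constant \<open>C\<close> can be followed
  from one \<open>z\<close> to another.\<close>

definition invertible_at where
  "invertible_at A z C \<longleftrightarrow> 0 \<le> C \<and>
    (\<forall>f\<in>V. \<exists>g\<in>V. ae_eq (\<lambda>x. A g x - z *\<^sub>C g x) f \<and> N g \<le> C * N f) \<and>
    (\<forall>g\<in>V. ae_eq (\<lambda>x. A g x - z *\<^sub>C g x) (\<lambda>x. 0) \<longrightarrow> ae_eq g (\<lambda>x. 0))"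

lemma invertible_at_solve:
  assumes "invertible_at A z C" "f \<in> V"
  obtains g where "g \<in> V" "ae_eq (\<lambda>x. A g x - z *\<^sub>C g x) f" "N g \<le> C * N f"
  using assms unfolding invertible_at_def by blast

lemma invertible_at_inj:
  assumes "invertible_at A z C" and A: "bounded_by A c" and "f \<in> V" "g \<in> V"
    and eq: "ae_eq (\<lambda>x. A f x - z *\<^sub>C f x) (\<lambda>x. A g x - z *\<^sub>C g x)"
  shows "ae_eq f g"
proof -
  have "ae_eq (\<lambda>x. A (\<lambda>x. f x - g x) x - z *\<^sub>C (f x - g x)) (\<lambda>x. (A f x - A g x) - z *\<^sub>C (f x - g x))"
    by (intro ae_eq_add ae_eq_diff ae_eq_scaleC op_diff[OF A] assms ae_eq_refl)
  also have "\<dots> = (\<lambda>x. (A f x - z *\<^sub>C f x) - (A g x - z *\<^sub>C g x))"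
    by (auto simp: scaleC_diff_right)
  also have "ae_eq \<dots> (\<lambda>x. 0)"
    using eq by (simp only: ae_eq_diff_zero)
  finally have "ae_eq (\<lambda>x. f x - g x) (\<lambda>x. 0)"
    using assms diff_mem[of f g] unfolding invertible_at_def by blast
  then show ?thesis by (simp only: ae_eq_diff_zero)
qed

lemma invertible_at_bound:
  assumes inv: "invertible_at A z C" and A: "bounded_by A c" and "f \<in> V"
  shows "N f \<le> C * N (\<lambda>x. A f x - z *\<^sub>C f x)"
proof -
  obtain g where g: "g \<in> V" "ae_eq (\<lambda>x. A g x - z *\<^sub>C g x) (\<lambda>x. A f x - z *\<^sub>C f x)"
    "N g \<le> C * N (\<lambda>x. A f x - z *\<^sub>C f x)"
    using invertible_at_solve[OF inv diff_mem[OF op_mem[OF A \<open>f \<in> V\<close>] scaleC_mem[OF \<open>f \<in> V\<close>]]] .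
  then show ?thesis
    using N_ae[OF g(1) invertible_at_inj[OF inv A g(1) \<open>f \<in> V\<close> g(2)]] by simp
qed

text \<open>The solution map \<open>B\<close> is an arbitrary choice of solutions. It is linear up
  to null sets because solutions are unique up to null sets (\<open>B_eqI\<close>).\<close>

lemma not_in_spectrumI:
  assumes inv: "invertible_at A z C" and A: "bounded_by A c"
  shows "z \<notin> op_spectrum V N A"
proof -
  have "\<forall>f\<in>V. \<exists>g. g \<in> V \<and> ae_eq (\<lambda>x. A g x - z *\<^sub>C g x) f \<and> N g \<le> C * N f"
    using inv unfolding invertible_at_def by blast
  from bchoice[OF this] obtain B where B: "\<And>f. f \<in> V \<Longrightarrow> B f \<in> V"
      "\<And>f. f \<in> V \<Longrightarrow> ae_eq (\<lambda>x. A (B f) x - z *\<^sub>C B f x) f"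
      "\<And>f. f \<in> V \<Longrightarrow> N (B f) \<le> C * N f"
    by blast
  have B_eqI: "ae_eq (B f) g" if "f \<in> V" "g \<in> V" "ae_eq (\<lambda>x. A g x - z *\<^sub>C g x) f" for f g
    using invertible_at_inj[OF inv A B(1)[OF that(1)] that(2)] B(2)[OF that(1)] that(3)
      ae_eq_sym ae_eq_trans by blast
  have "linear_op B"
    unfolding linear_op_def
  proof (intro conjI ballI allI)
    show "B ` V \<subseteq> V" using B by blast
  next
    fix f g assume fg: "f \<in> V" "g \<in> V"
    have "ae_eq (\<lambda>x. A (\<lambda>x. B f x + B g x) x - z *\<^sub>C (B f x + B g x))
        (\<lambda>x. (A (B f) x + A (B g) x) - z *\<^sub>C (B f x + B g x))"
      by (intro ae_eq_add ae_eq_diff ae_eq_scaleC op_add[OF A] B fg ae_eq_refl)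
    also have "\<dots> = (\<lambda>x. (A (B f) x - z *\<^sub>C B f x) + (A (B g) x - z *\<^sub>C B g x))"
      by (auto simp: scaleC_add_right)
    also have "ae_eq \<dots> (\<lambda>x. f x + g x)"
      by (intro ae_eq_add ae_eq_diff ae_eq_scaleC B fg)
    finally show "ae_eq (B (\<lambda>x. f x + g x)) (\<lambda>x. B f x + B g x)"
      by (intro B_eqI add_mem B fg)
  next
    fix f d assume f: "f \<in> V"
    have "ae_eq (\<lambda>x. A (\<lambda>x. d *\<^sub>C B f x) x - z *\<^sub>C d *\<^sub>C B f x) (\<lambda>x. d *\<^sub>C A (B f) x - z *\<^sub>C d *\<^sub>C B f x)"
      by (intro ae_eq_add ae_eq_diff ae_eq_scaleC op_scaleC[OF A] B f ae_eq_refl)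
    also have "\<dots> = (\<lambda>x. d *\<^sub>C (A (B f) x - z *\<^sub>C B f x))"
      by (auto simp: scaleC_diff_right scaleC_left_commute[of z d])
    also have "ae_eq \<dots> (\<lambda>x. d *\<^sub>C f x)"
      by (intro ae_eq_add ae_eq_diff ae_eq_scaleC B f)
    finally show "ae_eq (B (\<lambda>x. d *\<^sub>C f x)) (\<lambda>x. d *\<^sub>C B f x)"
      by (intro B_eqI scaleC_mem B f)
  qed
  then have "bounded_operator V N B"
    using B(3) inv by (intro bounded_by_imp_bounded_operator[of _ C])
      (auto simp: bounded_by_def invertible_at_def)
  moreover have "ae_eq (B (\<lambda>x. A f x - z *\<^sub>C f x)) f" if "f \<in> V" for f
    using that by (intro B_eqI diff_mem scaleC_mem op_mem[OF A] ae_eq_refl)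
  ultimately show ?thesis
    unfolding op_spectrum_def using B(2) by blast
qed

lemma not_in_spectrumE:
  assumes "z \<notin> op_spectrum V N A" and A: "bounded_by A c"
  obtains C where "invertible_at A z C"
proof -
  obtain B where B: "bounded_operator V N B"
      "\<And>f. f \<in> V \<Longrightarrow> ae_eq (B (\<lambda>x. A f x - z *\<^sub>C f x)) f"
      "\<And>f. f \<in> V \<Longrightarrow> ae_eq (\<lambda>x. A (B f) x - z *\<^sub>C B f x) f"
    using assms unfolding op_spectrum_def by blast
  obtain C where C: "bounded_by B C"
    using bounded_operator_imp_bounded_by[OF B(1)] by blast
  have "invertible_at A z C"
    unfolding invertible_at_def
  proof (intro conjI ballI impI)
    show "0 \<le> C" by (rule op_bound_nonneg[OF C])
    show "\<exists>g\<in>V. ae_eq (\<lambda>x. A g x - z *\<^sub>C g x) f \<and> N g \<le> C * N f" if "f \<in> V" for f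
      using B(3) op_mem[OF C] op_bound[OF C] that by blast
    show "ae_eq g (\<lambda>x. 0)" if g: "g \<in> V" "ae_eq (\<lambda>x. A g x - z *\<^sub>C g x) (\<lambda>x. 0)" for g
    proof -
      have mem: "(\<lambda>x. A g x - z *\<^sub>C g x) \<in> V"
        by (intro diff_mem scaleC_mem op_mem[OF A] g)
      have "N (B (\<lambda>x. A g x - z *\<^sub>C g x)) \<le> C * 0"
        using op_bound[OF C mem] N_eq_0_iff[OF mem] g(2) by simp
      then show ?thesis
        using N_ae[OF op_mem[OF C mem] B(2)[OF g(1)]] N_le_0_imp[OF g(1)] by simp
    qed
  qed
  then show ?thesis using that by blast
qed

section \<open>Iteration and Neumann series\<close>

text \<open>Only the orbit of 0 has to contract geometrically. The map \<open>\<Phi>\<close> itself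
  need merely be Lipschitz, with \<open>L\<close> possibly above 1; that suffices to pass to the
  limit in \<open>u (Suc n) = \<Phi> (u n)\<close>.\<close>

lemma fixed_point:
  fixes u :: "nat \<Rightarrow> real \<Rightarrow> 'h"
  assumes \<Phi>: "\<And>g. g \<in> V \<Longrightarrow> \<Phi> g \<in> V"
    and lip: "\<And>g h. g \<in> V \<Longrightarrow> h \<in> V \<Longrightarrow> N (\<lambda>x. \<Phi> g x - \<Phi> h x) \<le> L * N (\<lambda>x. g x - h x)"
    and q: "0 \<le> q" "q < 1"
    and u: "u 0 = (\<lambda>x. 0)" "\<And>n. u (Suc n) = \<Phi> (u n)"
    and step: "\<And>n. N (\<lambda>x. u (Suc n) x - u n x) \<le> K * q ^ n"
  shows "\<exists>g\<in>V. ae_eq (\<Phi> g) g \<and> N g \<le> K / (1 - q)"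
proof -
  have u_mem: "u n \<in> V" for n
    by (induction n) (auto simp: u \<Phi>)
  have K: "0 \<le> K"
    using step[of 0] N_nonneg[OF diff_mem[OF u_mem u_mem], of 1 0] by simp
  have dist: "N (\<lambda>x. u (m + k) x - u m x) \<le> K * (\<Sum>i<k. q ^ (m + i))" for m k
  proof (induction k)
    case (Suc k)
    have "N (\<lambda>x. u (m + Suc k) x - u m x)
        \<le> N (\<lambda>x. u (m + Suc k) x - u (m + k) x) + N (\<lambda>x. u (m + k) x - u m x)"
      by (intro N_triangle_diff u_mem)
    also have "\<dots> \<le> K * q ^ (m + k) + K * (\<Sum>i<k. q ^ (m + i))"
      using Suc step[of "m + k"] by simp
    finally show ?case by (simp add: algebra_simps)
  qed simp
  have geom: "N (\<lambda>x. u (m + k) x - u m x) \<le> q ^ m * (K / (1 - q))" for m k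
  proof -
    have "(\<Sum>i<k. q ^ i) \<le> (\<Sum>i. q ^ i)"
      using q by (intro sum_le_suminf summable_geometric) auto
    also have "\<dots> = 1 / (1 - q)"
      using q by (intro suminf_geometric) auto
    finally have "K * q ^ m * (\<Sum>i<k. q ^ i) \<le> K * q ^ m * (1 / (1 - q))"
      using q K by (intro mult_left_mono) auto
    moreover have "K * (\<Sum>i<k. q ^ (m + i)) = K * q ^ m * (\<Sum>i<k. q ^ i)"
      by (simp add: power_add sum_distrib_left mult.assoc)
    moreover have "K * q ^ m * (1 / (1 - q)) = q ^ m * (K / (1 - q))"
      by simp
    ultimately show ?thesis
      using dist[of m k] by linarith
  qed
  have tail: "(\<lambda>m. q ^ m * (K / (1 - q))) \<longlonglongrightarrow> 0"
    using q by (intro tendsto_mult_left_zero LIMSEQ_power_zero) auto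
  obtain g where g: "g \<in> V" and lim: "(\<lambda>n. N (\<lambda>x. u n x - g x)) \<longlonglongrightarrow> 0"
  proof (rule complete[of u])
    fix \<epsilon> :: real assume "0 < \<epsilon>"
    then obtain n0 where n0: "\<And>m. m \<ge> n0 \<Longrightarrow> q ^ m * (K / (1 - q)) < \<epsilon>"
      using order_tendstoD(2)[OF tail] unfolding eventually_sequentially by blast
    have "N (\<lambda>x. u m x - u n x) < \<epsilon>" if "m \<ge> n0" "n \<ge> n0" for m n
    proof (cases "n \<le> m")
      case True
      then show ?thesis using geom[of n "m - n"] n0[of n] that by simp
    next
      case False
      then show ?thesis
        using geom[of m "n - m"] n0[of m] that N_diff_commute[OF u_mem u_mem, of m n] by simp
    qed
    then show "\<exists>n0. \<forall>m\<ge>n0. \<forall>n\<ge>n0. N (\<lambda>x. u m x - u n x) < \<epsilon>" by blast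
  qed (use u_mem in auto)
  have "N (\<lambda>x. \<Phi> g x - g x) \<le> L * N (\<lambda>x. u n x - g x) + N (\<lambda>x. u (Suc n) x - g x)" for n
    using N_triangle_diff[OF \<Phi>[OF g] u_mem[of "Suc n"] g] lip[OF g u_mem[of n]]
      N_diff_commute[OF g u_mem[of n]] by (simp add: u)
  moreover have "(\<lambda>n. L * N (\<lambda>x. u n x - g x) + N (\<lambda>x. u (Suc n) x - g x)) \<longlonglongrightarrow> L * 0 + 0"
    by (intro tendsto_intros lim LIMSEQ_Suc)
  ultimately have "N (\<lambda>x. \<Phi> g x - g x) \<le> 0"
    by (intro LIMSEQ_le_const) auto
  then have "ae_eq (\<Phi> g) g"
    using N_le_0_imp[OF diff_mem[OF \<Phi>[OF g] g]] by (simp only: ae_eq_diff_zero)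
  moreover have "N g \<le> K / (1 - q) + N (\<lambda>x. u n x - g x)" for n
    using N_le_diff[OF g u_mem[of n]] geom[of 0 n] N_diff_commute[OF g u_mem[of n]] by (simp add: u)
  then have "N g \<le> K / (1 - q)"
    using tendsto_add[OF tendsto_const lim, of "K / (1 - q)"] by (intro LIMSEQ_le_const) auto
  ultimately show ?thesis using g by blast
qed

text \<open>\<open>(A - w) g = f\<close> is the same as \<open>(A - z) g = f + (w - z) g\<close>,
  and solving for the left-hand side contracts with factor \<open>|w - z| C\<close>. The admissible
  distance depends on \<open>C\<close> alone.\<close>

lemma invertible_at_open:
  assumes inv: "invertible_at A z C" and A: "bounded_by A c" and small: "cmod (w - z) * C < 1"
  shows "\<exists>C'. invertible_at A w C'"
proof -
  define q where "q = cmod (w - z) * C"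
  have C: "0 \<le> C" using inv by (simp add: invertible_at_def)
  have q: "0 \<le> q" "q < 1" using small C by (auto simp: q_def)
  have shift: "ae_eq (\<lambda>x. A g x - z *\<^sub>C g x) (\<lambda>x. f x + (w - z) *\<^sub>C g x)
      \<longleftrightarrow> ae_eq (\<lambda>x. A g x - w *\<^sub>C g x) f" for f g
    unfolding ae_eq_def by (auto simp: scaleC_diff_left algebra_simps elim: eventually_mono)
  have inj: "ae_eq g (\<lambda>x. 0)" if g: "g \<in> V" and eq: "ae_eq (\<lambda>x. A g x - w *\<^sub>C g x) (\<lambda>x. 0)" for g
  proof -
    have "ae_eq (\<lambda>x. A g x - z *\<^sub>C g x) (\<lambda>x. (w - z) *\<^sub>C g x)"
      using eq shift[of g "\<lambda>x. 0"] by simp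
    then have "N (\<lambda>x. A g x - z *\<^sub>C g x) = cmod (w - z) * N g"
      using N_ae[OF scaleC_mem[OF g]] ae_eq_sym N_scaleC[OF g] by metis
    then have "N g \<le> q * N g"
      using invertible_at_bound[OF inv A g] by (simp add: q_def mult_ac)
    then have "(1 - q) * N g \<le> 0" by (simp add: algebra_simps)
    then show ?thesis
      using q N_le_0_imp[OF g] by (simp add: mult_le_0_iff)
  qed
  have solve: "\<exists>g\<in>V. ae_eq (\<lambda>x. A g x - w *\<^sub>C g x) f \<and> N g \<le> (C / (1 - q)) * N f" if f: "f \<in> V" for f
  proof -
    have "\<forall>h\<in>V. \<exists>g. g \<in> V \<and> ae_eq (\<lambda>x. A g x - z *\<^sub>C g x) (\<lambda>x. f x + (w - z) *\<^sub>C h x)"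
      using invertible_at_solve[OF inv add_mem[OF f scaleC_mem]] by blast
    from bchoice[OF this] obtain \<Phi> where \<Phi>: "\<And>h. h \<in> V \<Longrightarrow> \<Phi> h \<in> V"
      "\<And>h. h \<in> V \<Longrightarrow> ae_eq (\<lambda>x. A (\<Phi> h) x - z *\<^sub>C \<Phi> h x) (\<lambda>x. f x + (w - z) *\<^sub>C h x)"
      by blast
    have lip: "N (\<lambda>x. \<Phi> g x - \<Phi> h x) \<le> q * N (\<lambda>x. g x - h x)" if gh: "g \<in> V" "h \<in> V" for g h
    proof -
      let ?d = "\<lambda>x. \<Phi> g x - \<Phi> h x"
      have d: "?d \<in> V" using gh \<Phi> diff_mem by blast
      have "ae_eq (\<lambda>x. A ?d x - z *\<^sub>C ?d x) (\<lambda>x. (A (\<Phi> g) x - A (\<Phi> h) x) - z *\<^sub>C ?d x)"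
        by (intro ae_eq_add ae_eq_diff ae_eq_scaleC op_diff[OF A] \<Phi> gh ae_eq_refl)
      also have "\<dots> = (\<lambda>x. (A (\<Phi> g) x - z *\<^sub>C \<Phi> g x) - (A (\<Phi> h) x - z *\<^sub>C \<Phi> h x))"
        by (auto simp: scaleC_diff_right)
      also have "ae_eq \<dots> (\<lambda>x. (f x + (w - z) *\<^sub>C g x) - (f x + (w - z) *\<^sub>C h x))"
        by (intro ae_eq_add ae_eq_diff ae_eq_scaleC \<Phi> gh)
      also have "\<dots> = (\<lambda>x. (w - z) *\<^sub>C (g x - h x))"
        by (auto simp: scaleC_diff_right)
      finally have "N (\<lambda>x. A ?d x - z *\<^sub>C ?d x) = cmod (w - z) * N (\<lambda>x. g x - h x)"
        using N_ae[OF scaleC_mem[OF diff_mem[OF gh]] ae_eq_sym] N_scaleC[OF diff_mem[OF gh]] by metis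
      then show ?thesis
        using invertible_at_bound[OF inv A d] by (simp add: q_def mult_ac)
    qed
    define u where "u n = (\<Phi> ^^ n) (\<lambda>x. 0)" for n
    have u_mem: "u n \<in> V" for n
      by (induction n) (auto simp: u_def \<Phi>)
    have first: "N (u 1) \<le> C * N f"
    proof -
      have "ae_eq f (\<lambda>x. A (u 1) x - z *\<^sub>C u 1 x)"
        using ae_eq_sym[OF \<Phi>(2)[OF zero_mem]] by (simp add: u_def)
      from N_ae[OF f this] show ?thesis
        using invertible_at_bound[OF inv A u_mem[of 1]] by simp
    qed
    have "N (\<lambda>x. u (Suc n) x - u n x) \<le> C * N f * q ^ n" for n
    proof (induction n)
      case 0
      show ?case using first by (simp add: u_def)
    next
      case (Suc n)
      have "N (\<lambda>x. u (Suc (Suc n)) x - u (Suc n) x) \<le> q * N (\<lambda>x. u (Suc n) x - u n x)"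
        using lip[OF u_mem[of "Suc n"] u_mem[of n]] by (simp add: u_def)
      also have "\<dots> \<le> q * (C * N f * q ^ n)"
        using Suc q by (intro mult_left_mono)
      finally show ?case by (simp add: mult_ac)
    qed
    then have "\<exists>g\<in>V. ae_eq (\<Phi> g) g \<and> N g \<le> (C * N f) / (1 - q)"
      by (intro fixed_point[where u = u and L = q] \<Phi> lip q) (auto simp: u_def)
    then obtain g where g: "g \<in> V" "ae_eq (\<Phi> g) g" "N g \<le> (C * N f) / (1 - q)"
      by blast
    have "ae_eq (\<lambda>x. A g x - z *\<^sub>C g x) (\<lambda>x. A (\<Phi> g) x - z *\<^sub>C \<Phi> g x)"
      by (intro ae_eq_add ae_eq_diff ae_eq_scaleC op_ae[OF A g(1)] ae_eq_scaleC) (use g ae_eq_sym in blast)+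
    then have "ae_eq (\<lambda>x. A g x - z *\<^sub>C g x) (\<lambda>x. f x + (w - z) *\<^sub>C g x)"
      using \<Phi>(2)[OF g(1)] ae_eq_trans by blast
    then show ?thesis
      using g shift[of g f] by auto
  qed
  have "invertible_at A w (C / (1 - q))"
    unfolding invertible_at_def using C q solve inj by auto
  then show ?thesis ..
qed

text \<open>The Neumann series converges because of the power bounds; the norm bound
  \<open>c\<close> of \<open>A\<close> may well exceed \<open>|w|\<close>. For injectivity,
  \<open>A g = w g\<close> gives \<open>|w|^k N g \<le> C r^k N g\<close> for all
  \<open>k\<close>.\<close>

lemma invertible_at_large:
  assumes A: "bounded_by A c" and "0 \<le> C" "0 \<le> r"
    and powers: "\<And>f k. f \<in> V \<Longrightarrow> N ((A ^^ k) f) \<le> C * r ^ k * N f"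
    and w: "r < cmod w"
  shows "\<exists>C'. invertible_at A w C'"
proof -
  define q where "q = r / cmod w"
  have w0: "0 < cmod w" using assms by linarith
  have q: "0 \<le> q" "q < 1" using assms w0 by (auto simp: q_def)
  have q_pow: "r ^ k / cmod w ^ k = q ^ k" for k by (simp add: q_def power_divide)
  have inj: "ae_eq g (\<lambda>x. 0)" if g: "g \<in> V" and eq: "ae_eq (\<lambda>x. A g x - w *\<^sub>C g x) (\<lambda>x. 0)" for g
  proof -
    have "ae_eq ((A ^^ k) g) (\<lambda>x. w ^ k *\<^sub>C g x)" for k
    proof (induction k)
      case (Suc k)
      have "ae_eq ((A ^^ Suc k) g) (A (\<lambda>x. w ^ k *\<^sub>C g x))"
        using op_ae[OF A op_power_mem[OF A g] Suc] by simp
      also have "ae_eq \<dots> (\<lambda>x. w ^ k *\<^sub>C A g x)"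
        by (intro op_scaleC[OF A] g)
      also have "ae_eq \<dots> (\<lambda>x. w ^ k *\<^sub>C w *\<^sub>C g x)"
        by (intro ae_eq_add ae_eq_diff ae_eq_scaleC) (use eq in \<open>simp only: ae_eq_diff_zero\<close>)
      finally show ?case by (simp add: scaleC_scaleC mult.commute)
    qed simp
    then have "N ((A ^^ k) g) = cmod w ^ k * N g" for k
      using N_ae[OF op_power_mem[OF A g]] N_scaleC[OF g] by (metis norm_power)
    then have "cmod w ^ k * N g \<le> C * r ^ k * N g" for k
      using powers[OF g] by metis
    then have "N g \<le> C * q ^ k * N g" for k
      using w0 by (simp add: q_pow[symmetric] field_simps)
    moreover have "(\<lambda>k. C * q ^ k * N g) \<longlonglongrightarrow> C * 0 * N g"
      using q by (intro tendsto_intros LIMSEQ_power_zero) auto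
    ultimately have "N g \<le> 0"
      by (intro LIMSEQ_le_const) auto
    then show ?thesis using N_le_0_imp[OF g] by simp
  qed
  have solve: "\<exists>g\<in>V. ae_eq (\<lambda>x. A g x - w *\<^sub>C g x) f \<and> N g \<le> (C / cmod w / (1 - q)) * N f"
    if f: "f \<in> V" for f
  proof -
    define \<Phi> where "\<Phi> g = (\<lambda>x. (1 / w) *\<^sub>C (A g x - f x))" for g
    have \<Phi>: "\<Phi> g \<in> V" if "g \<in> V" for g
      unfolding \<Phi>_def using that f by (intro scaleC_mem diff_mem op_mem[OF A])
    have \<Phi>_diff: "(\<lambda>x. \<Phi> g x - \<Phi> h x) = (\<lambda>x. (1 / w) *\<^sub>C (A g x - A h x))" for g h
      by (auto simp: \<Phi>_def scaleC_diff_right[symmetric])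
    have lip: "N (\<lambda>x. \<Phi> g x - \<Phi> h x) \<le> (c / cmod w) * N (\<lambda>x. g x - h x)" if gh: "g \<in> V" "h \<in> V" for g h
      using op_diff_bound[OF A gh] N_scaleC[OF diff_mem[OF op_mem[OF A] op_mem[OF A], OF gh], of "1 / w"] w0
      by (simp add: \<Phi>_diff norm_divide divide_right_mono)
    define u where "u n = (\<Phi> ^^ n) (\<lambda>x. 0)" for n
    have u_mem: "u n \<in> V" for n
      by (induction n) (auto simp: u_def \<Phi>)
    have A0: "ae_eq (A (\<lambda>x. 0)) (\<lambda>x. 0)"
      using op_scaleC[OF A zero_mem, of 0] by simp
    \<comment> \<open>The increments of the iteration started at 0 are the terms of the Neumann
      series.\<close>
    have steps: "ae_eq (\<lambda>x. u (Suc n) x - u n x) (\<lambda>x. (- (1 / w ^ Suc n)) *\<^sub>C (A ^^ n) f x)" for n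
    proof (induction n)
      case 0
      have "ae_eq (\<lambda>x. (1 / w) *\<^sub>C (A (\<lambda>x. 0) x - f x)) (\<lambda>x. (1 / w) *\<^sub>C (0 - f x))"
        by (intro ae_eq_add ae_eq_diff ae_eq_scaleC A0 ae_eq_refl)
      then show ?case by (simp add: u_def \<Phi>_def scaleC_minus_left scaleC_minus_right)
    next
      case (Suc n)
      let ?a = "- (1 / w ^ Suc n)"
      have eq: "(\<lambda>x. u (Suc (Suc n)) x - u (Suc n) x) = (\<lambda>x. (1 / w) *\<^sub>C (A (u (Suc n)) x - A (u n) x))"
        using \<Phi>_diff[of "u (Suc n)" "u n"] by (simp add: u_def)
      have "ae_eq (\<lambda>x. (1 / w) *\<^sub>C (A (u (Suc n)) x - A (u n) x))
          (\<lambda>x. (1 / w) *\<^sub>C A (\<lambda>x. u (Suc n) x - u n x) x)"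
        by (intro ae_eq_add ae_eq_diff ae_eq_scaleC ae_eq_sym[OF op_diff[OF A]] u_mem)
      also have "ae_eq \<dots> (\<lambda>x. (1 / w) *\<^sub>C A (\<lambda>x. ?a *\<^sub>C (A ^^ n) f x) x)"
        by (intro ae_eq_add ae_eq_diff ae_eq_scaleC op_ae[OF A] diff_mem u_mem Suc)
      also have "ae_eq \<dots> (\<lambda>x. (1 / w) *\<^sub>C ?a *\<^sub>C A ((A ^^ n) f) x)"
        by (intro ae_eq_add ae_eq_diff ae_eq_scaleC op_scaleC[OF A] op_power_mem[OF A] f)
      finally show ?case unfolding eq by (simp add: scaleC_scaleC)
    qed
    have step: "N (\<lambda>x. u (Suc n) x - u n x) \<le> (C / cmod w * N f) * q ^ n" for n
    proof -
      have "N (\<lambda>x. u (Suc n) x - u n x) = N ((A ^^ n) f) / cmod w ^ Suc n"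
        using N_ae[OF diff_mem[OF u_mem u_mem] steps] N_scaleC[OF op_power_mem[OF A f]]
        by (simp add: norm_divide norm_power norm_mult)
      also have "\<dots> \<le> C * r ^ n * N f / cmod w ^ Suc n"
        by (intro divide_right_mono powers f) simp
      finally show ?thesis by (simp add: q_pow[symmetric] field_simps)
    qed
    have "\<exists>g\<in>V. ae_eq (\<Phi> g) g \<and> N g \<le> (C / cmod w * N f) / (1 - q)"
      by (intro fixed_point[where u = u and L = "c / cmod w"] \<Phi> lip q step) (auto simp: u_def)
    then obtain g where g: "g \<in> V" "ae_eq (\<Phi> g) g" "N g \<le> (C / cmod w * N f) / (1 - q)"
      by blast
    have "ae_eq (\<lambda>x. w *\<^sub>C \<Phi> g x) (\<lambda>x. w *\<^sub>C g x)"
      by (intro ae_eq_add ae_eq_diff ae_eq_scaleC g)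
    then have "ae_eq (\<lambda>x. A g x - w *\<^sub>C g x) f"
      using w0 unfolding ae_eq_def \<Phi>_def by (auto simp: scaleC_scaleC algebra_simps elim!: eventually_mono)
    then show ?thesis using g by auto
  qed
  have "invertible_at A w (C / cmod w / (1 - q))"
    unfolding invertible_at_def using assms q solve inj by auto
  then show ?thesis ..
qed

text \<open>The case \<open>C = 1\<close>, \<open>r = c\<close> of the power bounds. It makes the
  supremum defining the spectral radius one over a bounded set.\<close>

lemma cmod_spectrum_le:
  assumes "bounded_by A c" "z \<in> op_spectrum V N A"
  shows "cmod z \<le> c"
proof (rule ccontr)
  assume "\<not> cmod z \<le> c"
  then have "\<exists>C'. invertible_at A z C'"
    using op_power_bound[OF assms(1)] op_bound_nonneg[OF assms(1)]
    by (intro invertible_at_large[OF assms(1), of 1 c]) auto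
  then show False using assms not_in_spectrumI by blast
qed

lemma cmod_le_spectral_radius:
  assumes "bounded_by A c" "z \<in> op_spectrum V N A"
  shows "cmod z \<le> op_spectral_radius V N A"
  unfolding op_spectral_radius_def
  using assms cmod_spectrum_le[OF assms(1)] by (intro cSUP_upper bdd_aboveI2) auto

end

context function_space
begin

lemma sum_mem: "finite I \<Longrightarrow> (\<And>i. i \<in> I \<Longrightarrow> f i \<in> V) \<Longrightarrow> (\<lambda>x. \<Sum>i\<in>I. f i x) \<in> V"
  by (induction I rule: finite_induct) (auto intro: add_mem)

lemma N_sum: "finite I \<Longrightarrow> (\<And>i. i \<in> I \<Longrightarrow> f i \<in> V) \<Longrightarrow> N (\<lambda>x. \<Sum>i\<in>I. f i x) \<le> (\<Sum>i\<in>I. N (f i))"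
proof (induction I rule: finite_induct)
  case (insert j I)
  have "N (\<lambda>x. f j x + (\<Sum>i\<in>I. f i x)) \<le> N (f j) + N (\<lambda>x. \<Sum>i\<in>I. f i x)"
    using insert by (intro N_add sum_mem) auto
  then show ?case using insert by fastforce
qed simp

end

subsection \<open>A smooth bump function\<close>

text \<open>The exponent \<open>k\<close> makes the family closed under differentiation up to linear
  combinations: the derivative of \<open>flat k\<close> is
  \<open>flat (k + 2) - k * flat (k + 1)\<close>.\<close>

definition flat :: "nat \<Rightarrow> real \<Rightarrow> real"
  where "flat k x = (if 0 < x then exp (- inverse x) * inverse x ^ k else 0)"

lemma flat_nonneg: "0 \<le> flat k x"
  by (simp add: flat_def)

lemma flat_tendsto_0: "(flat k \<longlongrightarrow> 0) (at 0)"
proof (rule filterlim_split_at)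
  show "(flat k \<longlongrightarrow> 0) (at_left 0)"
    by (rule tendsto_eventually) (auto simp: flat_def eventually_at_filter)
  have "((\<lambda>x::real. inverse x ^ k / exp (inverse x)) \<longlongrightarrow> 0) (at_right 0)"
    by (rule filterlim_compose[OF tendsto_power_div_exp_0 filterlim_inverse_at_top_right])
  then show "(flat k \<longlongrightarrow> 0) (at_right 0)"
    by (rule Lim_transform_eventually)
      (auto simp: flat_def eventually_at_filter exp_minus divide_inverse mult.commute)
qed

lemma flat_deriv: "(flat k has_real_derivative (flat (k + 2) x - k * flat (k + 1) x)) (at x)"
proof (cases x "0 :: real" rule: linorder_cases)
  case less
  have "((\<lambda>x. 0) has_real_derivative (flat (k + 2) x - k * flat (k + 1) x)) (at x)"
    using less by (simp add: flat_def)
  then show ?thesis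
    by (rule has_field_derivative_transform_within_open[where S = "{..<0}"])
      (use less in \<open>auto simp: flat_def\<close>)
next
  case equal
  have "((\<lambda>h. flat (k + 1) h) \<longlongrightarrow> 0) (at 0)"
    by (rule flat_tendsto_0)
  \<comment> \<open>Off 0 the difference quotient of \<open>flat k\<close> at 0 is exactly
    \<open>flat (k + 1)\<close>.\<close>
  then have "((\<lambda>h. (flat k (0 + h) - flat k 0) / h) \<longlongrightarrow> 0) (at 0)"
    by (rule Lim_transform_eventually)
      (auto simp: flat_def eventually_at_filter divide_inverse mult_ac)
  then show ?thesis
    using equal by (simp add: DERIV_def flat_def)
next
  case greater
  have "((\<lambda>x. exp (- inverse x) * inverse x ^ k) has_real_derivative
      (flat (k + 2) x - k * flat (k + 1) x)) (at x)"
  proof (rule DERIV_cong)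
    show "((\<lambda>x. exp (- inverse x) * inverse x ^ k) has_real_derivative
      exp (- inverse x) * inverse x ^ 2 * inverse x ^ k
        + exp (- inverse x) * (k * inverse x ^ (k - 1) * (- (inverse x ^ 2)))) (at x)"
      using greater by (auto intro!: derivative_eq_intros simp: power2_eq_square)
    show "exp (- inverse x) * inverse x ^ 2 * inverse x ^ k
        + exp (- inverse x) * (k * inverse x ^ (k - 1) * (- (inverse x ^ 2)))
      = flat (k + 2) x - k * flat (k + 1) x"
      using greater by (cases k) (simp_all add: flat_def power2_eq_square algebra_simps)
  qed
  then show ?thesis
    by (rule has_field_derivative_transform_within_open[where S = "{0<..}"])
      (use greater in \<open>auto simp: flat_def\<close>)
qed

text \<open>The generators vanish outside ]1, 3[, hence near 0, and the span contains the
  derivatives of its members; smoothness then follows by induction on the order.\<close>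

inductive_set flat_span :: "(real \<Rightarrow> complex) set" where
  prod: "(\<lambda>x. complex_of_real (flat k (x - 1) * flat l (3 - x))) \<in> flat_span"
| add: "f \<in> flat_span \<Longrightarrow> g \<in> flat_span \<Longrightarrow> (\<lambda>x. f x + g x) \<in> flat_span"
| scale: "f \<in> flat_span \<Longrightarrow> (\<lambda>x. r *\<^sub>R f x) \<in> flat_span"

lemma flat_span_deriv:
  "f \<in> flat_span \<Longrightarrow> \<exists>f'\<in>flat_span. \<forall>x. (f has_vector_derivative f' x) (at x)"
proof (induction rule: flat_span.induct)
  case (prod k l)
  define p where "p k l = (\<lambda>x. complex_of_real (flat k (x - 1) * flat l (3 - x)))" for k l
  let ?f' = "\<lambda>x. (p (k + 2) l x + (- real k) *\<^sub>R p (k + 1) l x)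
      + ((-1) *\<^sub>R p k (l + 2) x + real l *\<^sub>R p k (l + 1) x)"
  have "?f' \<in> flat_span"
    unfolding p_def by (intro flat_span.add flat_span.scale flat_span.prod)
  moreover have "(p k l has_vector_derivative ?f' x) (at x)" for x
  proof -
    have "((\<lambda>x. flat k (x - 1)) has_real_derivative (flat (k + 2) (x - 1) - k * flat (k + 1) (x - 1)) * 1) (at x)"
      by (rule DERIV_chain2[OF flat_deriv]) (auto intro!: derivative_eq_intros)
    moreover have "((\<lambda>x. flat l (3 - x)) has_real_derivative (flat (l + 2) (3 - x) - l * flat (l + 1) (3 - x)) * (-1)) (at x)"
      by (rule DERIV_chain2[OF flat_deriv]) (auto intro!: derivative_eq_intros)
    ultimately have "((\<lambda>x. flat k (x - 1) * flat l (3 - x)) has_real_derivative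
       ((flat (k + 2) (x - 1) - k * flat (k + 1) (x - 1)) * flat l (3 - x)
        - (flat (l + 2) (3 - x) - l * flat (l + 1) (3 - x)) * flat k (x - 1))) (at x)"
      by (auto intro!: derivative_eq_intros simp: algebra_simps)
    from has_vector_derivative_of_real[OF this, where 'a = complex] show ?thesis
      by (simp add: p_def algebra_simps scaleR_conv_of_real)
  qed
  ultimately have "\<exists>f'\<in>flat_span. \<forall>x. (p k l has_vector_derivative f' x) (at x)"
    by (intro bexI[of _ ?f']) auto
  then show ?case unfolding p_def .
next
  case (add f g)
  then obtain f' g' where "f' \<in> flat_span" "g' \<in> flat_span"
    "\<forall>x. (f has_vector_derivative f' x) (at x)" "\<forall>x. (g has_vector_derivative g' x) (at x)"
    by blast
  then show ?case
    by (intro bexI[of _ "\<lambda>x. f' x + g' x"]) (auto intro: has_vector_derivative_add flat_span.add)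
next
  case (scale f r)
  then obtain f' where "f' \<in> flat_span" "\<forall>x. (f has_vector_derivative f' x) (at x)"
    by blast
  then show ?case
    by (intro bexI[of _ "\<lambda>x. r *\<^sub>R f' x"])
      (auto intro: flat_span.scale bounded_linear.has_vector_derivative[OF bounded_linear_scaleR_right])
qed

lemma smooth_flat_span:
  assumes "f \<in> flat_span" shows "smooth f"
proof -
  have "nth_deriv n f \<in> flat_span" for n
  proof (induction n)
    case (Suc n)
    obtain f' where f': "f' \<in> flat_span" "\<forall>x. (nth_deriv n f has_vector_derivative f' x) (at x)"
      using flat_span_deriv[OF Suc] by blast
    have "nth_deriv (Suc n) f = (\<lambda>x. vector_derivative (nth_deriv n f) (at x))"
      by (simp add: nth_deriv_def)
    also have "\<dots> = f'"
      using f'(2) vector_derivative_at by fastforce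
    finally show ?case using f'(1) by simp
  qed (use assms in \<open>simp add: nth_deriv_def\<close>)
  then show ?thesis
    unfolding smooth_def using flat_span_deriv differentiableI_vector by meson
qed

definition bump :: "real \<Rightarrow> real"
  where "bump x = flat 0 (x - 1) * flat 0 (3 - x)"

lemma bump_nonneg: "0 \<le> bump x"
  by (simp add: bump_def flat_nonneg)

lemma bump_test_function: "(\<lambda>x. complex_of_real (bump x)) \<in> test_functions"
proof -
  have "smooth (\<lambda>x. complex_of_real (bump x))"
    unfolding bump_def by (intro smooth_flat_span flat_span.prod)
  moreover have sub: "fsupport (\<lambda>x. complex_of_real (bump x)) \<subseteq> {1..3}"
    unfolding fsupport_def by (rule closure_minimal) (auto simp: bump_def flat_def split: if_splits)
  moreover have "closed (fsupport (\<lambda>x. complex_of_real (bump x)))"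
    by (simp add: fsupport_def)
  then have "compact (fsupport (\<lambda>x. complex_of_real (bump x)))"
    using sub compact_eq_bounded_closed bounded_subset[OF bounded_closed_interval[of 1 3]] by blast
  ultimately show ?thesis
    unfolding test_functions_def by force
qed

text \<open>Both factors are at least exp (-2) here. The interval has length 1, so its integer
  translates cover the line.\<close>

lemma bump_ge:
  assumes "3/2 \<le> x" "x \<le> 5/2"
  shows "exp (-4) \<le> bump x"
proof -
  have ge: "exp (-2) \<le> flat 0 t" if "1/2 \<le> t" for t :: real
    using that by (simp add: flat_def field_simps)
  have "exp (-2) * exp (-2) \<le> flat 0 (x - 1) * flat 0 (3 - x)"
    using assms by (intro mult_mono ge) (auto simp: flat_nonneg)
  then show ?thesis
    by (simp add: bump_def exp_add[symmetric])
qed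

subsection \<open>Translations and null sets\<close>

lemma AE_lebesgue_translate:
  assumes "AE x in lebesgue. P (x::real)"
  shows "AE x in lebesgue. P (x + c)"
proof -
  obtain S where S: "negligible S" "{x. \<not> P x} \<subseteq> S"
    using assms unfolding eventually_ae_filter_negligible by blast
  have "{x. \<not> P (x + c)} \<subseteq> (+) (- c) ` S"
  proof
    fix x assume "x \<in> {x. \<not> P (x + c)}"
    then have "x + c \<in> S" using S by blast
    then show "x \<in> (+) (- c) ` S" by (intro image_eqI[of _ _ "x + c"]) auto
  qed
  then show ?thesis
    unfolding eventually_ae_filter_negligible using negligible_translation[OF S(1)] by blast
qed

text \<open>Countably many translates of a null set form a null set, so a relation valid almost
  everywhere can be iterated along the whole orbit of almost every point.\<close>

lemma AE_half_line_orbit: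
  assumes "AE x in lebesgue_on {0..}. P (x::real)"
  shows "AE x in lebesgue_on {0..}. \<forall>j::int. 0 \<le> x + j \<longrightarrow> P (x + j)"
proof -
  have "AE x in lebesgue. \<forall>j::int. 0 \<le> x + j \<longrightarrow> P (x + j)"
    unfolding AE_all_countable
    using AE_lebesgue_translate[OF assms[unfolded AE_half_line_iff]] by blast
  then show ?thesis
    unfolding AE_half_line_iff by (auto elim: eventually_mono)
qed

lemma AE_half_line_translate:
  assumes "AE x in lebesgue_on {0..}. P (x::real)"
  shows "AE x in lebesgue_on {0..}. 0 \<le> x + c \<longrightarrow> P (x + c)"
  using AE_lebesgue_translate[OF assms[unfolded AE_half_line_iff], of c]
  unfolding AE_half_line_iff by (auto elim: eventually_mono)

lemma ae_eq_translation:
  assumes "ae_eq f g" shows "ae_eq (translation a f) (translation a g)"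
  using AE_half_line_translate[OF assms[unfolded ae_eq_def], of "- a"]
  unfolding ae_eq_def translation_def by (auto elim: eventually_mono)

lemma translation_measurable:
  fixes F :: "real \<Rightarrow> 'b::{real_normed_vector, second_countable_topology}"
  assumes "F \<in> borel_measurable (lebesgue_on {0..})"
  shows "translation a F \<in> borel_measurable (lebesgue_on {0..})"
proof -
  have F0: "(\<lambda>x. indicator {0..} x *\<^sub>R F x) \<in> borel_measurable lebesgue"
    using assms by (subst borel_measurable_restrict_space_iff[symmetric]) auto
  have "(\<lambda>x. x - a) \<in> lebesgue \<rightarrow>\<^sub>M lebesgue"
    using lebesgue_affine_measurable[where c = "\<lambda>x::real. 1" and t = "- a"] by simp
  from measurable_compose[OF this F0]
  have "(\<lambda>x. indicator {0..} (x - a) *\<^sub>R F (x - a)) \<in> borel_measurable lebesgue" .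
  also have "(\<lambda>x. indicator {0..} (x - a) *\<^sub>R F (x - a)) = translation a F"
    by (auto simp: translation_def indicator_def)
  finally show ?thesis by (rule measurable_restrict_space1)
qed

lemma scaleC_conv_scaleR: "c *\<^sub>C v = Re c *\<^sub>R v + Im c *\<^sub>R (\<i> *\<^sub>C (v::'h::chilbert_space))"
  by (metis complex_eq mult.commute scaleC_add_left scaleC_of_real scaleC_scaleC)

text \<open>The product splits into real scalings of \<open>F\<close> and of \<i> times
  \<open>F\<close>, and multiplication by \<i> is a bounded real-linear map.\<close>

lemma scaleC_measurable:
  fixes F :: "real \<Rightarrow> 'h::{chilbert_space, second_countable_topology}"
  assumes [measurable]: "u \<in> borel_measurable M" "F \<in> borel_measurable M"
  shows "(\<lambda>x. u x *\<^sub>C F x) \<in> borel_measurable M"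
proof -
  have "bounded_linear (\<lambda>v::'h. \<i> *\<^sub>C v)"
    by (rule bounded_linear_intro[where K = 1])
      (auto simp: scaleC_add_right scaleC_of_real[symmetric] scaleC_scaleC mult.commute)
  then have "(\<lambda>v::'h. \<i> *\<^sub>C v) \<in> borel_measurable borel"
    by (intro borel_measurable_continuous_onI linear_continuous_on)
  from measurable_compose[OF assms(2) this]
  have [measurable]: "(\<lambda>x. \<i> *\<^sub>C F x) \<in> borel_measurable M" .
  show ?thesis
    unfolding scaleC_conv_scaleR[of "u _"] by measurable
qed

lemma translation_add: "translation a (\<lambda>x. f x + g x) = (\<lambda>x. translation a f x + translation a g (x::real) :: 'b::monoid_add)"
  by (auto simp: translation_def)

lemma translation_scaleC: "translation a (\<lambda>x. c *\<^sub>C f x) = (\<lambda>x. c *\<^sub>C translation a f x :: 'b::chilbert_space)"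
  by (auto simp: translation_def)

lemma norm_translation: "norm (translation a F x) = translation a (\<lambda>x. norm (F x)) x"
  by (auto simp: translation_def)

subsection \<open>Averages of cosines\<close>

text \<open>The derivative \<open>cos t - 1/2\<close> is nonnegative on [0, 1] since 1 <
  \<pi>/3.\<close>

lemma half_le_sin:
  fixes x :: real
  assumes "0 \<le> x" "x \<le> 1"
  shows "x / 2 \<le> sin x"
proof -
  have "sin 0 - 0 / 2 \<le> sin x - x / 2"
  proof (rule DERIV_nonneg_imp_nondecreasing[OF assms(1)])
    fix t assume t: "0 \<le> t" "t \<le> x"
    have "cos (pi / 3) \<le> cos t"
      using t assms pi_gt3 by (intro cos_monotone_0_pi_le) auto
    then have "0 \<le> cos t - 1 / 2" by (simp add: cos_60)
    moreover have "((\<lambda>x. sin x - x / 2) has_real_derivative cos t - 1 / 2) (at t)"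
      by (auto intro!: derivative_eq_intros)
    ultimately show "\<exists>y. ((\<lambda>x. sin x - x / 2) has_real_derivative y) (at t) \<and> 0 \<le> y"
      by blast
  qed
  then show ?thesis by simp
qed

text \<open>Telescoping, as for the Dirichlet kernel, bounds the sum times
  \<open>2 * sin (y / 2)\<close> by 1. Since \<open>sin (y / 2)\<close> is at least
  \<open>y / 4\<close>, the sum is at most \<open>2 / y\<close>, which is at most
  \<open>K / 2\<close>.\<close>

lemma avg_cos_le_half:
  fixes y :: real
  assumes y: "0 < y" "y \<le> 1" and K: "4 \<le> y * real K"
  shows "(\<Sum>j = 1..K. cos (real j * y)) / K \<le> 1/2"
proof -
  have K0: "0 < real K"
    using y K by (cases K) auto
  have sin: "y / 4 \<le> sin (y / 2)"
    using half_le_sin[of "y / 2"] y by simp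
  have "(\<Sum>j = 1..K. cos (real j * y)) * (2 * sin (y / 2)) = sin ((K + 1/2) * y) - sin (y / 2)"
  proof (induction K)
    case (Suc K)
    have "cos (Suc K * y) * (2 * sin (y / 2)) = sin ((Suc K + 1/2) * y) - sin ((K + 1/2) * y)"
      using sin_add[of "Suc K * y" "y/2"] sin_diff[of "Suc K * y" "y/2"]
      by (simp add: algebra_simps)
    then show ?case using Suc by (simp add: algebra_simps)
  qed simp
  also have "\<dots> \<le> 1"
    using sin_le_one[of "(K + 1/2) * y"] sin y by linarith
  finally have *: "(\<Sum>j = 1..K. cos (real j * y)) * (2 * sin (y / 2)) \<le> 1" .
  have "(\<Sum>j = 1..K. cos (real j * y)) \<le> K / 2"
  proof (rule ccontr)
    assume "\<not> ?thesis"
    then have gt: "K / 2 < (\<Sum>j = 1..K. cos (real j * y))" by simp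
    have "1 \<le> K / 2 * (2 * (y / 4))"
      using K by (simp add: mult.commute)
    also have "\<dots> < (\<Sum>j = 1..K. cos (real j * y)) * (2 * (y / 4))"
      using gt y by (intro mult_strict_right_mono) auto
    also have "\<dots> \<le> (\<Sum>j = 1..K. cos (real j * y)) * (2 * sin (y / 2))"
      using sin gt K0 by (intro mult_left_mono) auto
    finally show False using * by simp
  qed
  then show ?thesis using K0 by (simp add: field_simps)
qed

lemma one_minus_cos_le: "1 - cos x \<le> x\<^sup>2 / 2" for x :: real
proof -
  have "1 - cos x = 2 * (sin (x / 2))\<^sup>2"
    using cos_double_sin[of "x / 2"] by simp
  also have "(sin (x / 2))\<^sup>2 \<le> (x / 2)\<^sup>2"
    by (rule abs_le_square_iff[THEN iffD1, OF abs_sin_x_le_abs_x])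
  finally show ?thesis by (simp add: power_divide)
qed

subsection \<open>The vector-valued space as a Banach lattice\<close>

lemma indicator_measurable:
  "A \<in> sets borel \<Longrightarrow> (indicator A :: real \<Rightarrow> real) \<in> borel_measurable (lebesgue_on {0..})"
  by (intro measurable_restrict_space1 borel_measurable_indicator) auto

text \<open>Multiplication by the unit vector \<open>e\<close> embeds the nonnegative functions of E
  isometrically into the vector space. Solidity is proved on the vector side and brought back to E
  in this way.\<close>

locale half_line_space =
  fixes E :: "(real \<Rightarrow> complex) set" and N :: "(real \<Rightarrow> complex) \<Rightarrow> real"
    and e :: "'h::{chilbert_space, second_countable_topology}"
  assumes E_banach: "banach_function_space E N"
    and H1: "hyp_H1 E N" and H2: "hyp_H2 E N" and H3: "hyp_H3 E N"
    and V_banach: "banach_function_space (vec_space E :: (real \<Rightarrow> 'h) set) (vec_norm N)"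
    and norm_e: "norm e = 1"
begin

sublocale E: function_space E N
  by unfold_locales (rule E_banach)

sublocale V: function_space "vec_space E :: (real \<Rightarrow> 'h) set" "vec_norm N"
  by unfold_locales (rule V_banach)

abbreviation V :: "(real \<Rightarrow> 'h) set" where "V \<equiv> vec_space E"
abbreviation M :: "(real \<Rightarrow> 'h) \<Rightarrow> real" where "M \<equiv> vec_norm N"

lemma V_memI: "F \<in> borel_measurable (lebesgue_on {0..}) \<Longrightarrow> (\<lambda>x. complex_of_real (norm (F x))) \<in> E \<Longrightarrow> F \<in> V"
  by (simp add: vec_space_def)

lemma V_memD: "F \<in> V \<Longrightarrow> (\<lambda>x. complex_of_real (norm (F x))) \<in> E"
  by (simp add: vec_space_def)

lemma V_same_norm:
  assumes "F \<in> V" "G \<in> borel_measurable (lebesgue_on {0..})" "\<And>x. norm (G x) = norm (F x)"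
  shows "G \<in> V" "M G = M F"
  using assms by (auto simp: vec_space_def vec_norm_def)

text \<open>A multiplier with values in \<open>[0, 1]\<close> is the average of two unimodular ones, which preserve
  the norm.\<close>

lemma solid:
  assumes F: "F \<in> V" and G [measurable]: "G \<in> borel_measurable (lebesgue_on {0..})"
    and le: "AE x in lebesgue_on {0..}. norm (G x) \<le> norm (F x)"
  shows "G \<in> V" "M G \<le> M F"
proof -
  \<comment> \<open>Cutting at 1 makes \<open>\<phi>\<close> the real part of a unimodular number
    everywhere, also on the exceptional null set.\<close>
  define \<phi> where "\<phi> x = min 1 (norm (G x) / norm (F x))" for x
  define u where "u x = Complex (\<phi> x) (sqrt (1 - (\<phi> x)\<^sup>2))" for x
  have [measurable]: "F \<in> borel_measurable (lebesgue_on {0..})"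
    using F by (rule V.measurable)
  have \<phi>01: "0 \<le> \<phi> x" "\<phi> x \<le> 1" for x by (auto simp: \<phi>_def)
  have [measurable]: "\<phi> \<in> borel_measurable (lebesgue_on {0..})"
    unfolding \<phi>_def by measurable
  have u_meas: "u \<in> borel_measurable (lebesgue_on {0..})"
      "(\<lambda>x. cnj (u x)) \<in> borel_measurable (lebesgue_on {0..})"
    unfolding borel_measurable_complex_iff u_def by simp_all
  have u_norm: "cmod (u x) = 1" for x
    using \<phi>01[of x] by (simp add: u_def cmod_def abs_square_le_1)
  note Fu = V_same_norm[OF F scaleC_measurable[OF u_meas(1) V.measurable[OF F]]]
  note Fu' = V_same_norm[OF F scaleC_measurable[OF u_meas(2) V.measurable[OF F]]]
  have avg: "(\<lambda>x. (1/2) *\<^sub>C (u x *\<^sub>C F x + cnj (u x) *\<^sub>C F x)) = (\<lambda>x. \<phi> x *\<^sub>R F x)"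
  proof
    fix x
    have "u x + cnj (u x) = complex_of_real (2 * \<phi> x)"
      by (simp add: complex_add_cnj u_def)
    then show "(1/2) *\<^sub>C (u x *\<^sub>C F x + cnj (u x) *\<^sub>C F x) = \<phi> x *\<^sub>R F x"
      by (simp add: scaleC_add_left[symmetric] scaleC_scaleC scaleC_of_real)
  qed
  have mem: "(\<lambda>x. \<phi> x *\<^sub>R F x) \<in> V"
    unfolding avg[symmetric] by (intro V.scaleC_mem V.add_mem Fu Fu') (simp_all add: u_norm)
  have "M (\<lambda>x. \<phi> x *\<^sub>R F x) = (1/2) * M (\<lambda>x. u x *\<^sub>C F x + cnj (u x) *\<^sub>C F x)"
    unfolding avg[symmetric]
    by (subst V.N_scaleC) (auto intro!: V.add_mem Fu Fu' simp: u_norm norm_divide)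
  also have "\<dots> \<le> (1/2) * (M (\<lambda>x. u x *\<^sub>C F x) + M (\<lambda>x. cnj (u x) *\<^sub>C F x))"
    by (intro mult_left_mono V.N_add Fu Fu') (simp_all add: u_norm)
  also have "\<dots> = M F"
    using Fu(2) Fu'(2) by (simp add: u_norm)
  finally have bound: "M (\<lambda>x. \<phi> x *\<^sub>R F x) \<le> M F" .
  \<comment> \<open>The functions \<open>\<phi> F\<close> and \<open>G\<close> need not agree. Their
    pointwise norms do almost everywhere, and for measurable functions membership and norm depend on
    nothing else.\<close>
  have eq: "ae_eq (\<lambda>x. complex_of_real (norm (\<phi> x *\<^sub>R F x))) (\<lambda>x. complex_of_real (norm (G x)))"
    using le unfolding ae_eq_def
  proof (rule eventually_mono)
    fix x assume "norm (G x) \<le> norm (F x)"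
    then have "norm (\<phi> x *\<^sub>R F x) = norm (G x)"
      by (cases "F x = 0") (auto simp: \<phi>_def min_def field_simps)
    then show "complex_of_real (norm (\<phi> x *\<^sub>R F x)) = complex_of_real (norm (G x))" by simp
  qed
  show "G \<in> V"
    using V_memI[OF G] E.ae_closed[OF V_memD[OF mem] eq] by simp
  show "M G \<le> M F"
    using bound E.N_ae[OF V_memD[OF mem] eq] by (simp add: vec_norm_def)
qed

abbreviation R :: "(real \<Rightarrow> real) \<Rightarrow> real \<Rightarrow> complex" where "R g \<equiv> (\<lambda>x. complex_of_real (g x))"

lemma R_measurable: "R g \<in> E \<Longrightarrow> g \<in> borel_measurable (lebesgue_on {0..})"
  using measurable_compose[OF E.measurable, of "R g" Re borel] by simp

lemma lift_mem:
  assumes "R g \<in> E" "\<And>x. 0 \<le> g x"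
  shows "(\<lambda>x. g x *\<^sub>R e) \<in> V" "M (\<lambda>x. g x *\<^sub>R e) = N (R g)"
  using R_measurable[OF assms(1)] assms by (auto simp: vec_space_def vec_norm_def norm_e)

text \<open>Lifted to the vector space along \<open>e\<close> and read back. The absolute values
  occur because nonnegativity holds only almost everywhere, while \<open>lift_mem\<close> asks for
  it at every point.\<close>

lemma E_solid:
  assumes g: "R g \<in> E" and h [measurable]: "h \<in> borel_measurable (lebesgue_on {0..})"
    and le: "AE x in lebesgue_on {0..}. 0 \<le> h x \<and> h x \<le> g x"
  shows "R h \<in> E" "N (R h) \<le> N (R g)"
proof -
  have g_eq: "ae_eq (R g) (R (\<lambda>x. \<bar>g x\<bar>))"
    using le unfolding ae_eq_def by (rule eventually_mono) simp
  have h_eq: "ae_eq (R (\<lambda>x. \<bar>h x\<bar>)) (R h)"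
    using le unfolding ae_eq_def by (rule eventually_mono) simp
  have F: "(\<lambda>x. \<bar>g x\<bar> *\<^sub>R e) \<in> V" "M (\<lambda>x. \<bar>g x\<bar> *\<^sub>R e) = N (R g)"
    using lift_mem[of "\<lambda>x. \<bar>g x\<bar>"] E.ae_closed[OF g g_eq] E.N_ae[OF g g_eq] by auto
  have "AE x in lebesgue_on {0..}. norm (\<bar>h x\<bar> *\<^sub>R e) \<le> norm (\<bar>g x\<bar> *\<^sub>R e)"
    using le by (rule eventually_mono) (simp add: norm_e)
  note G = solid[OF F(1) _ this]
  have "R (\<lambda>x. \<bar>h x\<bar>) \<in> E"
    using V_memD[OF G(1)] by (simp add: norm_e)
  moreover have "N (R (\<lambda>x. \<bar>h x\<bar>)) \<le> N (R g)"
    using G(2) F(2) by (simp add: vec_norm_def norm_e)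
  ultimately show "R h \<in> E" "N (R h) \<le> N (R g)"
    using E.ae_closed[OF _ h_eq] E.N_ae[OF _ h_eq] by auto
qed

text \<open>The factor 4 counts the positive and negative parts of the real and imaginary parts,
  each dominated by \<open>g\<close>.\<close>

lemma E_solid_complex:
  assumes g: "R g \<in> E" and h [measurable]: "h \<in> borel_measurable (lebesgue_on {0..})"
    and le: "AE x in lebesgue_on {0..}. cmod (h x) \<le> g x"
  shows "h \<in> E" "N h \<le> 4 * N (R g)"
proof -
  have part: "R (\<lambda>x. max 0 (p (h x))) \<in> E \<and> N (R (\<lambda>x. max 0 (p (h x)))) \<le> N (R g)"
    if [measurable]: "p \<in> borel_measurable borel" and p: "\<And>z. p z \<le> cmod z" for p
  proof -
    have "(\<lambda>x. max 0 (p (h x))) \<in> borel_measurable (lebesgue_on {0..})"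
      by measurable
    moreover have "AE x in lebesgue_on {0..}. 0 \<le> max 0 (p (h x)) \<and> max 0 (p (h x)) \<le> g x"
      using le
    proof (rule eventually_mono)
      fix x assume "cmod (h x) \<le> g x"
      then show "0 \<le> max 0 (p (h x)) \<and> max 0 (p (h x)) \<le> g x"
        using p[of "h x"] order_trans[OF norm_ge_zero \<open>cmod (h x) \<le> g x\<close>] by auto
    qed
    ultimately show ?thesis using E_solid[OF g] by blast
  qed
  define p1 where "p1 = R (\<lambda>x. max 0 (Re (h x)))"
  define p2 where "p2 = R (\<lambda>x. max 0 (- Re (h x)))"
  define p3 where "p3 = R (\<lambda>x. max 0 (Im (h x)))"
  define p4 where "p4 = R (\<lambda>x. max 0 (- Im (h x)))"
  have p1: "p1 \<in> E" "N p1 \<le> N (R g)" unfolding p1_def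
    using part[of Re] by (auto simp: complex_Re_le_cmod)
  have p2: "p2 \<in> E" "N p2 \<le> N (R g)" unfolding p2_def
    using part[of "\<lambda>z. - Re z"] abs_Re_le_cmod by (auto simp: abs_le_iff)
  have p3: "p3 \<in> E" "N p3 \<le> N (R g)" unfolding p3_def
    using part[of Im] abs_Im_le_cmod by (auto simp: abs_le_iff)
  have p4: "p4 \<in> E" "N p4 \<le> N (R g)" unfolding p4_def
    using part[of "\<lambda>z. - Im z"] abs_Im_le_cmod by (auto simp: abs_le_iff)
  have h_eq: "h = (\<lambda>x. (p1 x - p2 x) + \<i> *\<^sub>C (p3 x - p4 x))"
    by (auto simp: p1_def p2_def p3_def p4_def scaleC_complex_def complex_eq_iff max_def)
  show "h \<in> E"
    unfolding h_eq using p1 p2 p3 p4 by (intro E.add_mem E.diff_mem E.scaleC_mem)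
  have "N h \<le> N (\<lambda>x. p1 x - p2 x) + N (\<lambda>x. \<i> *\<^sub>C (p3 x - p4 x))"
    unfolding h_eq using p1 p2 p3 p4 by (intro E.N_add E.diff_mem E.scaleC_mem)
  also have "N (\<lambda>x. \<i> *\<^sub>C (p3 x - p4 x)) = N (\<lambda>x. p3 x - p4 x)"
    using E.N_scaleC[OF E.diff_mem[OF p3(1) p4(1)], of \<i>] by simp
  finally show "N h \<le> 4 * N (R g)"
    using E.N_diff[OF p1(1) p2(1)] E.N_diff[OF p3(1) p4(1)] p1 p2 p3 p4 by simp
qed

lemma E_translation:
  "\<exists>c\<ge>0. \<forall>f\<in>E. translation a f \<in> E \<and> N (translation a f) \<le> c * N f"
proof -
  have "compact {a}" by simp
  then have "(SUP b\<in>{a}. op_norm E N (translation b)) < \<infinity>"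
    using H2 unfolding hyp_H2_def by blast
  then have fin: "op_norm E N (translation a) < \<infinity>" by simp
  have maps: "translation a ` E \<subseteq> E"
    using H2 unfolding hyp_H2_def by blast
  have "N (translation a f) \<le> enn2real (op_norm E N (translation a)) * N f" if "f \<in> E" for f
    by (rule E.op_normD[OF fin maps _ that]) (simp_all add: translation_scaleC)
  then show ?thesis
    using maps by (intro exI[of _ "enn2real (op_norm E N (translation a))"]) auto
qed

lemma V_translation: "\<exists>c. V.bounded_by (translation a) c"
proof -
  obtain c where c: "0 \<le> c" "\<And>f. f \<in> E \<Longrightarrow> translation a f \<in> E"
    "\<And>f. f \<in> E \<Longrightarrow> N (translation a f) \<le> c * N f"
    using E_translation[of a] by blast
  have norm_eq: "(\<lambda>x. complex_of_real (norm (translation a F x)))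
      = translation a (\<lambda>x. complex_of_real (norm (F x)))" for F :: "real \<Rightarrow> 'h"
    by (auto simp: translation_def)
  have "translation a F \<in> V" if "F \<in> V" for F
    using V_memI[OF translation_measurable[OF V.measurable[OF that], of a]] c(2)[OF V_memD[OF that]]
    by (simp add: norm_eq)
  moreover have "M (translation a F) \<le> c * M F" if "F \<in> V" for F
    using c(3)[OF V_memD[OF that]] by (simp add: vec_norm_def norm_eq)
  ultimately have "V.bounded_by (translation a) c"
    unfolding V.bounded_by_def V.linear_op_def using c(1)
    by (auto simp: translation_add translation_scaleC)
  then show ?thesis ..
qed

text \<open>The hypotheses supply only test functions. Finitely many integer translates of
  \<open>bump\<close>, scaled by exp 4, dominate the indicator, and solidity does the rest.\<close>

lemma indicator_mem: "R (indicator {0..b}) \<in> E"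
proof -
  define g where "g x = (\<Sum>j\<in>{-2..\<lceil>b\<rceil>}. translation (of_int j) bump x)" for x
  have "(\<lambda>x. \<Sum>j\<in>{-2..\<lceil>b\<rceil>}. translation (of_int j) (R bump) x) \<in> E"
  proof (rule E.sum_mem)
    fix j
    have "R bump \<in> E"
      using H1 bump_test_function unfolding hyp_H1_def by blast
    then show "translation (of_int j) (R bump) \<in> E"
      using H2 unfolding hyp_H2_def by blast
  qed simp
  also have "(\<lambda>x. \<Sum>j\<in>{-2..\<lceil>b\<rceil>}. translation (of_int j) (R bump) x) = R g"
    unfolding g_def of_real_sum by (intro ext sum.cong) (auto simp: translation_def)
  finally have g: "R (\<lambda>x. exp 4 * g x) \<in> E"
    using E.scaleC_mem[of "R g" "complex_of_real (exp 4)"] by (simp add: scaleC_complex_def)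
  have tr_nonneg: "0 \<le> translation t bump x" for t x
    by (simp add: translation_def bump_nonneg)
  have g_ge: "1 \<le> exp 4 * g x" if x: "0 \<le> x" "x \<le> b" for x
  proof -
    \<comment> \<open>This puts \<open>x - j\<close> into [3/2, 5/2[. For x < 1/2 it gives j = -2:
      bumps must also be moved to the left, since they vanish near 0.\<close>
    define j where "j = \<lfloor>x - 3/2\<rfloor>"
    have j: "of_int j \<le> x - 3/2" "x - 3/2 < of_int j + 1"
      unfolding j_def by linarith+
    have "j \<in> {-2..\<lceil>b\<rceil>}" using j x by (auto; linarith)
    then have "translation (of_int j) bump x \<le> g x"
      unfolding g_def using tr_nonneg by (intro member_le_sum) auto
    moreover have "exp (-4) \<le> translation (of_int j) bump x"
      using bump_ge[of "x - of_int j"] j by (simp add: translation_def)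
    ultimately have "exp 4 * exp (-4) \<le> exp 4 * g x"
      by (intro mult_left_mono) auto
    then show ?thesis by (simp add: exp_add[symmetric])
  qed
  have g_nonneg: "0 \<le> g x" for x
    unfolding g_def using tr_nonneg by (intro sum_nonneg)
  have "0 \<le> (indicator {0..b} x :: real) \<and> indicator {0..b} x \<le> exp 4 * g x" for x
    using g_ge[of x] g_nonneg[of x] by (auto simp: indicator_def)
  then show ?thesis
    by (intro E_solid(1)[OF g]) (auto intro!: indicator_measurable)
qed

subsection \<open>Density of compactly supported functions\<close>

text \<open>By the triangle inequality a norm ball is open in
  \<open>seminorm_topology E {N}\<close>, so it meets the dense set of test functions.\<close>

lemma test_approx:
  assumes f: "f \<in> E" and "0 < \<epsilon>"
  obtains \<phi> where "\<phi> \<in> test_functions" "N (\<lambda>x. f x - \<phi> x) < \<epsilon>"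
proof -
  define T where "T = {g \<in> E. N (\<lambda>x. g x - f x) < \<epsilon>}"
  have "openin (seminorm_topology E {N}) T"
    unfolding openin_seminorm_topology
  proof (intro conjI ballI)
    show "T \<subseteq> E" by (auto simp: T_def)
    fix g assume g: "g \<in> T"
    have "k \<in> T" if "k \<in> E" "N (\<lambda>x. k x - g x) < \<epsilon> - N (\<lambda>x. g x - f x)" for k
      using E.N_triangle_diff[of k g f] that g f by (auto simp: T_def)
    then show "\<exists>Q \<epsilon>. finite Q \<and> Q \<subseteq> {N} \<and> \<epsilon> > 0 \<and>
        (\<forall>k\<in>E. (\<forall>p\<in>Q. p (\<lambda>x. k x - g x) < \<epsilon>) \<longrightarrow> k \<in> T)"
      using g by (intro exI[of _ "{N}"] exI[of _ "\<epsilon> - N (\<lambda>x. g x - f x)"]) (auto simp: T_def)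
  qed
  moreover have "f \<in> T" using f \<open>0 < \<epsilon>\<close> by (simp add: T_def)
  moreover have "f \<in> (seminorm_topology E {N}) closure_of test_functions"
    using H1 f unfolding hyp_H1_def by blast
  ultimately obtain \<phi> where "\<phi> \<in> test_functions" "\<phi> \<in> T"
    unfolding in_closure_of by blast
  then show ?thesis
    using that E.N_diff_commute[of \<phi> f] f by (auto simp: T_def)
qed

lemma modulation_bound:
  "\<exists>C\<ge>0. \<forall>a. \<forall>f\<in>E. modulation a f \<in> E \<and> N (modulation a f) \<le> C * N f"
proof (intro exI conjI allI ballI)
  let ?C = "enn2real (SUP a. op_norm E N (modulation a))"
  fix a f assume f: "f \<in> E"
  have "bounded_operator E N (modulation a)"
    using H3 unfolding hyp_H3_def by blast
  then have b: "E.bounded_by (modulation a) (enn2real (op_norm E N (modulation a)))"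
    by (rule E.bounded_operator_imp_bounded_by)
  show "modulation a f \<in> E" by (rule E.op_mem[OF b f])
  have "enn2real (op_norm E N (modulation a)) \<le> ?C"
    using H3 unfolding hyp_H3_def by (intro enn2real_mono SUP_upper) auto
  then have "enn2real (op_norm E N (modulation a)) * N f \<le> ?C * N f"
    using E.N_nonneg[OF f] by (rule mult_right_mono)
  then show "N (modulation a f) \<le> ?C * N f"
    using E.op_bound[OF b f] by linarith
qed simp

text \<open>A single \<open>1 - cos (t * x)\<close> vanishes again after each period; averaging over
  \<open>j\<close> keeps the value away from 0 on a long stretch of the common period.\<close>

definition cos_mean :: "nat \<Rightarrow> real \<Rightarrow> real \<Rightarrow> real"
  where "cos_mean K t x = (\<Sum>j = 1..K. 1 - cos (real j * (t * x))) / K"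

text \<open>\<open>1 - cos (s * x)\<close> is the identity minus the mean of the modulations by
  \<open>s\<close> and \<open>- s\<close>, so by (H3) its norm is at most \<open>1 + C\<close>.
  Averaging keeps this bound, which is therefore uniform in \<open>K\<close> and
  \<open>t\<close>.\<close>

lemma cos_mean_multiplier:
  "\<exists>C\<ge>0. \<forall>K t. \<forall>f\<in>E. 0 < K \<longrightarrow> (\<lambda>x. complex_of_real (cos_mean K t x) * f x) \<in> E \<and>
    N (\<lambda>x. complex_of_real (cos_mean K t x) * f x) \<le> C * N f"
proof -
  obtain C where C: "0 \<le> C" "\<And>a f. f \<in> E \<Longrightarrow> modulation a f \<in> E"
    "\<And>a f. f \<in> E \<Longrightarrow> N (modulation a f) \<le> C * N f"
    using modulation_bound by blast
  define h where "h s f = (\<lambda>x. f x - (1/2) *\<^sub>C (modulation s f x + modulation (- s) f x))" for s f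
  have h_eq: "h s f = (\<lambda>x. complex_of_real (1 - cos (s * x)) * f x)" for s f
  proof
    fix x
    have "modulation s f x + modulation (- s) f x = complex_of_real (2 * cos (s * x)) * f x"
      by (simp add: modulation_def cos_exp_eq cos_of_real[symmetric] algebra_simps del: cos_of_real)
    then show "h s f x = complex_of_real (1 - cos (s * x)) * f x"
      by (simp only: h_def scaleC_complex_def) (simp add: algebra_simps)
  qed
  have h_mem: "h s f \<in> E" if "f \<in> E" for s f
    unfolding h_def using that C(2) by (intro E.diff_mem E.scaleC_mem E.add_mem)
  have h_bound: "N (h s f) \<le> (1 + C) * N f" if f: "f \<in> E" for s f
  proof -
    let ?m = "\<lambda>x. modulation s f x + modulation (- s) f x"
    have m: "?m \<in> E" using f C(2) by (intro E.add_mem)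
    have "N ?m \<le> 2 * (C * N f)"
      using E.N_add[OF C(2) C(2), OF f f, of s "- s"] C(3)[OF f, of s] C(3)[OF f, of "- s"] by simp
    moreover have "N (h s f) \<le> N f + N (\<lambda>x. (1/2) *\<^sub>C ?m x)"
      unfolding h_def by (rule E.N_diff[OF f E.scaleC_mem[OF m]])
    moreover have "N (\<lambda>x. (1/2) *\<^sub>C ?m x) = N ?m / 2"
      using E.N_scaleC[OF m, of "1/2"] by (simp add: norm_divide)
    ultimately show ?thesis by (simp add: algebra_simps)
  qed
  have mean_eq: "(\<lambda>x. complex_of_real (cos_mean K t x) * f x)
      = (\<lambda>x. (1 / of_nat K) *\<^sub>C (\<Sum>j = 1..K. h (real j * t) f x))" for K t f
    by (simp add: cos_mean_def h_eq scaleC_complex_def sum_distrib_right[symmetric] mult.assoc)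
  have sum_mem: "(\<lambda>x. \<Sum>j = 1..K. h (real j * t) f x) \<in> E" if "f \<in> E" for K t f
    using that by (intro E.sum_mem h_mem) auto
  show ?thesis
  proof (intro exI[of _ "1 + C"] conjI allI ballI impI)
    fix K t f assume K: "0 < (K::nat)" and f: "f \<in> E"
    show "(\<lambda>x. complex_of_real (cos_mean K t x) * f x) \<in> E"
      unfolding mean_eq by (intro E.scaleC_mem sum_mem f)
    have "N (\<lambda>x. \<Sum>j = 1..K. h (real j * t) f x) \<le> (\<Sum>j = 1..K. N (h (real j * t) f))"
      by (intro E.N_sum h_mem f) auto
    also have "\<dots> \<le> (\<Sum>j = 1..K. (1 + C) * N f)"
      by (intro sum_mono h_bound f)
    finally have "N (\<lambda>x. \<Sum>j = 1..K. h (real j * t) f x) \<le> K * ((1 + C) * N f)"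
      by simp
    then have "1 / K * N (\<lambda>x. \<Sum>j = 1..K. h (real j * t) f x) \<le> 1 / K * (K * ((1 + C) * N f))"
      by (intro mult_left_mono) auto
    then show "N (\<lambda>x. complex_of_real (cos_mean K t x) * f x) \<le> (1 + C) * N f"
      unfolding mean_eq using E.N_scaleC[OF sum_mem[where K = K and t = t, OF f], of "1 / of_nat K"] K
      by (simp add: norm_divide)
  qed (use C in simp)
qed

text \<open>The frequencies \<open>j * \<delta> / K\<close> are at most \<open>\<delta>\<close>, so
  every term has the same quadratic bound, whatever \<open>K\<close> is.\<close>

lemma cos_mean_le:
  assumes "0 < K" "0 \<le> x" "x \<le> B" "0 \<le> \<delta>"
  shows "0 \<le> cos_mean K (\<delta> / K) x" "cos_mean K (\<delta> / K) x \<le> (\<delta> * B)\<^sup>2 / 2"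
proof -
  have "1 - cos (real j * (\<delta> / K * x)) \<le> (\<delta> * B)\<^sup>2 / 2" if "j \<in> {1..K}" for j
  proof -
    have "real j / K * (\<delta> * x) \<le> 1 * (\<delta> * B)"
      using assms that by (intro mult_mono) auto
    then have "(real j * (\<delta> / K * x))\<^sup>2 \<le> (\<delta> * B)\<^sup>2"
      using assms by (intro power_mono) auto
    then show ?thesis using one_minus_cos_le[of "real j * (\<delta> / K * x)"] by linarith
  qed
  then have "(\<Sum>j = 1..K. 1 - cos (real j * (\<delta> / K * x))) \<le> (\<Sum>j = 1..K. (\<delta> * B)\<^sup>2 / 2)"
    by (rule sum_mono)
  then show "cos_mean K (\<delta> / K) x \<le> (\<delta> * B)\<^sup>2 / 2"
    using \<open>0 < K\<close> by (simp add: cos_mean_def field_simps)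
  show "0 \<le> cos_mean K (\<delta> / K) x"
    unfolding cos_mean_def by (intro divide_nonneg_nonneg sum_nonneg) auto
qed

text \<open>With y = \<delta> x / K the assumptions become 4 \<le> y K and y \<le> 1, as
  \<open>avg_cos_le_half\<close> requires. The left threshold does not involve
  \<open>K\<close>.\<close>

lemma cos_mean_ge:
  assumes "0 < \<delta>" "4 / \<delta> \<le> x" "\<delta> * x \<le> K"
  shows "1/2 \<le> cos_mean K (\<delta> / K) x"
proof -
  have \<delta>x: "4 \<le> \<delta> * x" using assms by (simp add: field_simps)
  then have K: "0 < real K" using assms by linarith
  have "(\<Sum>j = 1..K. cos (real j * (\<delta> / K * x))) / K \<le> 1/2"
    using K \<delta>x assms by (intro avg_cos_le_half) (auto simp: field_simps)
  then show ?thesis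
    using K by (simp add: cos_mean_def sum_subtractf diff_divide_distrib)
qed

text \<open>The multiplier \<^const>\<open>cos_mean\<close> is small on the support of a test function close to \<open>g\<close>, so
  by (H3) it makes the norm of \<open>g\<close> small; being at least \<open>1/2\<close> on the interval, it controls
  the truncation of \<open>g\<close> there.\<close>

lemma tail_small:
  assumes g: "R g \<in> E" and g0: "\<And>x. 0 \<le> g x" and \<epsilon>: "0 < \<epsilon>"
  obtains r where "\<And>b. N (R (\<lambda>x. indicator {r..b} x * g x)) \<le> \<epsilon>"
proof -
  obtain C where C: "0 \<le> C"
    "\<And>K t f. 0 < K \<Longrightarrow> f \<in> E \<Longrightarrow> (\<lambda>x. complex_of_real (cos_mean K t x) * f x) \<in> E"
    "\<And>K t f. 0 < K \<Longrightarrow> f \<in> E \<Longrightarrow> N (\<lambda>x. complex_of_real (cos_mean K t x) * f x) \<le> C * N f"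
    using cos_mean_multiplier by metis
  \<comment> \<open>Chosen so that the error terms \<open>C * \<eta>\<close> and
    \<open>\<eta>\<close> add up to half of \<open>\<epsilon>\<close>.\<close>
  define \<eta> where "\<eta> = \<epsilon> / (2 * (C + 1))"
  have \<eta>: "0 < \<eta>" "2 * (C * \<eta> + \<eta>) = \<epsilon>"
  proof -
    show "0 < \<eta>" using \<epsilon> C(1) by (simp add: \<eta>_def)
    have "2 * (C * \<eta> + \<eta>) = 2 * (C + 1) * \<eta>" by (simp add: algebra_simps)
    then show "2 * (C * \<eta> + \<eta>) = \<epsilon>" using C(1) by (simp add: \<eta>_def)
  qed
  obtain \<phi> where \<phi>: "\<phi> \<in> test_functions" "N (\<lambda>x. R g x - \<phi> x) < \<eta>"
    using test_approx[OF g \<eta>(1)] .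
  have \<phi>E: "\<phi> \<in> E" using \<phi>(1) H1 unfolding hyp_H1_def by blast
  have supp: "compact (fsupport \<phi>)" "fsupport \<phi> \<subseteq> {0<..}" "smooth \<phi>"
    using \<phi>(1) by (auto simp: test_functions_def)
  have outside: "x \<in> fsupport \<phi>" if "\<phi> x \<noteq> 0" for x
    using that closure_subset[of "{x. \<phi> x \<noteq> 0}"] by (auto simp: fsupport_def)
  obtain B where B: "0 < B" "\<And>x. \<phi> x \<noteq> 0 \<Longrightarrow> \<bar>x\<bar> \<le> B"
    using compact_imp_bounded[OF supp(1)] outside unfolding bounded_pos by auto
  have "\<phi> differentiable (at x)" for x
    using supp(3) unfolding smooth_def nth_deriv_def by (metis funpow_0)
  then have "continuous_on UNIV \<phi>"
    by (simp add: continuous_at_imp_continuous_on differentiable_imp_continuous_within)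
  then have "compact (\<phi> ` fsupport \<phi>)"
    using supp(1) continuous_on_subset by (intro compact_continuous_image) auto
  then have "\<exists>D>0. \<forall>y\<in>\<phi> ` fsupport \<phi>. cmod y \<le> D"
    by (intro bounded_pos[THEN iffD1] compact_imp_bounded)
  then obtain D where D: "0 < D" "\<And>x. x \<in> fsupport \<phi> \<Longrightarrow> cmod (\<phi> x) \<le> D"
    by blast
  define I where "I = N (R (indicator {0..B}))"
  have I: "0 \<le> I" unfolding I_def by (rule E.N_nonneg[OF indicator_mem])
  \<comment> \<open>The norm of \<open>m * \<phi>\<close> will be at most \<delta>^2 P I, where
    \<open>P\<close> collects \<open>B\<close> and \<open>D\<close> with the factors 1/2 and 4 from
    \<open>cos_mean_le\<close> and \<open>E_solid_complex\<close>. Replacing \<open>I\<close> by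
    \<open>J\<close> gives a positive denominator.\<close>
  define J where "J = I + 1"
  define P where "P = 2 * D * B\<^sup>2"
  define \<delta> where "\<delta> = sqrt (\<eta> / (P * J))"
  have J: "0 < J" "I \<le> J" using I by (auto simp: J_def)
  have P: "0 < P" using D B by (simp add: P_def)
  have \<delta>: "0 < \<delta>" using \<eta> P J by (simp add: \<delta>_def)
  have \<delta>2: "(\<delta> * B)\<^sup>2 / 2 * D * 4 * I \<le> \<eta>"
  proof -
    have "\<delta>\<^sup>2 = \<eta> / (P * J)" using \<eta> P J by (simp add: \<delta>_def)
    then have "\<delta>\<^sup>2 * P * I = \<eta> * (I / J)"
      using P J by (simp add: field_simps)
    moreover have "(\<delta> * B)\<^sup>2 / 2 * D * 4 * I = \<delta>\<^sup>2 * P * I"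
      by (simp add: P_def power_mult_distrib)
    ultimately have "(\<delta> * B)\<^sup>2 / 2 * D * 4 * I = \<eta> * (I / J)"
      by simp
    also have "\<dots> \<le> \<eta> * 1" using \<eta> I J by (intro mult_left_mono) auto
    finally show ?thesis by simp
  qed
  have "N (R (\<lambda>x. indicator {4 / \<delta>..b} x * g x)) \<le> \<epsilon>" for b
  proof -
    \<comment> \<open>\<open>K\<close> grows with \<open>b\<close>, whereas \<open>\<delta>\<close>,
      \<open>C\<close> and the left end \<open>4 / \<delta>\<close> do not depend on
      \<open>b\<close>.\<close>
    define K where "K = nat \<lceil>max 1 (\<delta> * b)\<rceil>"
    have K: "0 < K" "\<delta> * b \<le> K" unfolding K_def by linarith+
    define m where "m = cos_mean K (\<delta> / K)"
    have mg: "R (\<lambda>x. m x * g x) \<in> E"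
      using C(2)[OF K(1) g, of "\<delta> / K"] by (simp add: m_def)
    have g_meas [measurable]: "g \<in> borel_measurable (lebesgue_on {0..})"
      by (rule R_measurable[OF g])
    have m\<phi>: "N (\<lambda>x. complex_of_real (m x) * \<phi> x) \<le> \<eta>"
    proof -
      have gE: "R (\<lambda>x. (\<delta> * B)\<^sup>2 / 2 * D * indicator {0..B} x) \<in> E"
        using E.scaleC_mem[OF indicator_mem, of "complex_of_real ((\<delta> * B)\<^sup>2 / 2 * D)" B]
        by (simp add: scaleC_complex_def)
      have "cmod (complex_of_real (m x) * \<phi> x) \<le> (\<delta> * B)\<^sup>2 / 2 * D * indicator {0..B} x" for x
      proof (cases "\<phi> x = 0")
        case True
        then show ?thesis using D(1) by simp
      next
        case False
        then have x: "0 \<le> x" "x \<le> B"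
          using outside[OF False] supp(2) B(2)[OF False] by auto
        then have "\<bar>m x\<bar> * cmod (\<phi> x) \<le> (\<delta> * B)\<^sup>2 / 2 * D"
          using cos_mean_le[OF K(1) x, of \<delta>] \<delta> D(2)[OF outside[OF False]]
          by (intro mult_mono) (auto simp: m_def)
        then show ?thesis using x by (simp add: norm_mult)
      qed
      then have "N (\<lambda>x. complex_of_real (m x) * \<phi> x) \<le> 4 * N (R (\<lambda>x. (\<delta> * B)\<^sup>2 / 2 * D * indicator {0..B} x))"
        using C(2)[OF K(1) \<phi>E, of "\<delta> / K"] by (intro E_solid_complex(2)[OF gE] E.measurable) (auto simp: m_def)
      also have "N (R (\<lambda>x. (\<delta> * B)\<^sup>2 / 2 * D * indicator {0..B} x)) = (\<delta> * B)\<^sup>2 / 2 * D * I"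
        using E.N_scaleC[OF indicator_mem, of "complex_of_real ((\<delta> * B)\<^sup>2 / 2 * D)" B] D(1)
        by (simp add: scaleC_complex_def I_def norm_mult norm_power norm_divide power_mult_distrib)
      finally show ?thesis using \<delta>2 by (simp add: mult_ac)
    qed
    have diff: "(\<lambda>x. R g x - \<phi> x) \<in> E" by (rule E.diff_mem[OF g \<phi>E])
    \<comment> \<open>The multiplier acts on the complex error \<open>g - \<phi>\<close> through
      (H3), so the absolute value of that error never enters.\<close>
    have "N (R (\<lambda>x. m x * g x)) = N (\<lambda>x. complex_of_real (m x) * (R g x - \<phi> x) + complex_of_real (m x) * \<phi> x)"
      by (simp add: algebra_simps)
    also have "\<dots> \<le> N (\<lambda>x. complex_of_real (m x) * (R g x - \<phi> x)) + N (\<lambda>x. complex_of_real (m x) * \<phi> x)"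
      unfolding m_def by (intro E.N_add C(2)[OF K(1)] diff \<phi>E)
    also have "N (\<lambda>x. complex_of_real (m x) * (R g x - \<phi> x)) \<le> C * N (\<lambda>x. R g x - \<phi> x)"
      unfolding m_def by (rule C(3)[OF K(1) diff])
    also have "C * N (\<lambda>x. R g x - \<phi> x) \<le> C * \<eta>"
      using C(1) \<phi>(2) by (intro mult_left_mono) auto
    finally have mg_small: "N (R (\<lambda>x. m x * g x)) \<le> C * \<eta> + \<eta>" using m\<phi> by simp
    have g2: "R (\<lambda>x. 2 * (m x * g x)) \<in> E" "N (R (\<lambda>x. 2 * (m x * g x))) = 2 * N (R (\<lambda>x. m x * g x))"
      using E.scaleC_mem[OF mg, of 2] E.N_scaleC[OF mg, of 2] by (simp_all add: scaleC_complex_def)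
    have "indicator {4 / \<delta>..b} x * g x \<le> 2 * (m x * g x)" if "0 \<le> x" for x
    proof (cases "x \<in> {4 / \<delta>..b}")
      case True
      then have "\<delta> * x \<le> \<delta> * b" using \<delta> by (intro mult_left_mono) auto
      then have "\<delta> * x \<le> K" using K(2) by linarith
      then have "1/2 \<le> m x" using True \<delta> unfolding m_def by (intro cos_mean_ge) auto
      then show ?thesis using True mult_right_mono[of "1/2" "m x" "g x"] g0[of x] by simp
    next
      case False
      then show ?thesis using g0[of x] cos_mean_le(1)[OF K(1) that order_refl, of \<delta>] \<delta> by (simp add: m_def)
    qed
    then have "AE x in lebesgue_on {0..}. 0 \<le> indicator {4 / \<delta>..b} x * g x \<and>
        indicator {4 / \<delta>..b} x * g x \<le> 2 * (m x * g x)"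
      using g0 by (auto simp: AE_half_line_iff)
    then have "N (R (\<lambda>x. indicator {4 / \<delta>..b} x * g x)) \<le> N (R (\<lambda>x. 2 * (m x * g x)))"
      by (intro E_solid(2)[OF g2(1)] borel_measurable_times indicator_measurable g_meas) auto
    also have "\<dots> \<le> 2 * (C * \<eta> + \<eta>)"
      unfolding g2(2) using mg_small by (intro mult_left_mono) auto
    finally show ?thesis unfolding \<eta>(2) .
  qed
  then show ?thesis using that by blast
qed

lemma truncation_mem:
  assumes F: "F \<in> V"
  shows "(\<lambda>x. indicator {a..<b} x *\<^sub>R F x) \<in> V" "M (\<lambda>x. indicator {a..<b} x *\<^sub>R F x) \<le> M F"
proof -
  have [measurable]: "F \<in> borel_measurable (lebesgue_on {0..})"
    by (rule V.measurable[OF F])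
  have "(\<lambda>x. indicator {a..<b} x *\<^sub>R F x) \<in> borel_measurable (lebesgue_on {0..})"
    by (intro borel_measurable_scaleR) (auto intro!: indicator_measurable)
  moreover have "AE x in lebesgue_on {0..}. norm (indicator {a..<b} x *\<^sub>R F x) \<le> norm (F x)"
    by (auto simp: indicator_def)
  ultimately show "(\<lambda>x. indicator {a..<b} x *\<^sub>R F x) \<in> V" "M (\<lambda>x. indicator {a..<b} x *\<^sub>R F x) \<le> M F"
    using solid[OF F] by blast+
qed

text \<open>\<open>tail_small\<close> controls bounded intervals only, so what it gives is a Cauchy
  sequence. Completeness yields a limit, which must be \<open>F\<close> because it agrees with
  \<open>F\<close> almost everywhere on each [0, k[.\<close>

lemma truncation_tendsto:
  assumes F: "F \<in> V"
  shows "(\<lambda>n. M (\<lambda>x. F x - indicator {0..<real n} x *\<^sub>R F x)) \<longlonglongrightarrow> 0"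
proof -
  define T where "T n = (\<lambda>x. indicator {0..<real n} x *\<^sub>R F x)" for n
  have T: "T n \<in> V" for n unfolding T_def by (rule truncation_mem[OF F])
  have mono: "\<exists>n0. \<forall>n\<ge>n0. \<forall>m\<ge>n. M (\<lambda>x. T m x - T n x) \<le> \<epsilon>" if \<epsilon>: "0 < \<epsilon>" for \<epsilon>
  proof -
    obtain r where r: "\<And>b. N (R (\<lambda>x. indicator {r..b} x * norm (F x))) \<le> \<epsilon>"
      using tail_small[OF V_memD[OF F] _ \<epsilon>] by auto
    have "M (\<lambda>x. T m x - T n x) \<le> \<epsilon>" if n: "r \<le> real n" "n \<le> m" for m n
    proof -
      have E1: "R (\<lambda>x. indicator {r..real m} x * norm (F x)) \<in> E"
        by (intro E_solid(1)[OF V_memD[OF F]] borel_measurable_times indicator_measurable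
            R_measurable[OF V_memD[OF F]]) (auto simp: indicator_def)
      have "N (R (\<lambda>x. norm (T m x - T n x))) \<le> N (R (\<lambda>x. indicator {r..real m} x * norm (F x)))"
        using V.measurable[OF V.diff_mem[OF T T]] n
        by (intro E_solid(2)[OF E1] borel_measurable_norm) (auto simp: T_def indicator_def AE_half_line_iff)
      then show ?thesis using r[of "real m"] by (simp add: vec_norm_def)
    qed
    then show ?thesis
      by (intro exI[of _ "nat \<lceil>r\<rceil>"]) (auto simp: nat_le_iff ceiling_le_iff)
  qed
  obtain G where G: "G \<in> V" "(\<lambda>n. M (\<lambda>x. T n x - G x)) \<longlonglongrightarrow> 0"
  proof (rule V.complete[of T])
    fix \<epsilon> :: real assume "0 < \<epsilon>"
    then obtain n0 where n0: "\<And>n m. n0 \<le> n \<Longrightarrow> n \<le> m \<Longrightarrow> M (\<lambda>x. T m x - T n x) \<le> \<epsilon> / 2"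
      using mono[of "\<epsilon> / 2"] by auto
    have "M (\<lambda>x. T m x - T n x) < \<epsilon>" if "n0 \<le> m" "n0 \<le> n" for m n
      using n0[of n m] n0[of m n] that V.N_diff_commute[OF T T, of m n] \<open>0 < \<epsilon>\<close>
      by (cases "n \<le> m") auto
    then show "\<exists>n0. \<forall>m\<ge>n0. \<forall>n\<ge>n0. M (\<lambda>x. T m x - T n x) < \<epsilon>" by blast
  qed (rule T)
  have local: "ae_eq (\<lambda>x. indicator {0..<real k} x *\<^sub>R (F x - G x)) (\<lambda>x. 0)" for k
  proof (rule V.N_le_0_imp)
    show "(\<lambda>x. indicator {0..<real k} x *\<^sub>R (F x - G x)) \<in> V"
      by (rule truncation_mem[OF V.diff_mem[OF F G(1)]])
    have "M (\<lambda>x. indicator {0..<real k} x *\<^sub>R (F x - G x)) \<le> M (\<lambda>x. T n x - G x)" if "k \<le> n" for n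
    proof -
      have "(\<lambda>x. indicator {0..<real k} x *\<^sub>R (F x - G x)) = (\<lambda>x. indicator {0..<real k} x *\<^sub>R (T n x - G x))"
        using that by (auto simp: T_def indicator_def)
      then show ?thesis using truncation_mem(2)[OF V.diff_mem[OF T G(1)]] by simp
    qed
    then show "M (\<lambda>x. indicator {0..<real k} x *\<^sub>R (F x - G x)) \<le> 0"
      by (intro LIMSEQ_le_const[OF G(2)]) blast
  qed
  have "AE x in lebesgue_on {0..}. \<forall>k. indicator {0..<real k} x *\<^sub>R (F x - G x) = 0"
    unfolding AE_all_countable using local by (simp add: ae_eq_def)
  then have "AE x in lebesgue. 0 \<le> x \<longrightarrow> F x = G x"
    unfolding AE_half_line_iff
  proof (rule eventually_mono, intro impI)
    fix x :: real
    assume *: "0 \<le> x \<longrightarrow> (\<forall>k. indicator {0..<real k} x *\<^sub>R (F x - G x) = 0)" and "0 \<le> x"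
    obtain k where "x < real k" using reals_Archimedean2 by blast
    then show "F x = G x" using *[rule_format, of k] \<open>0 \<le> x\<close> by simp
  qed
  then have eq: "ae_eq G F"
    by (auto simp: ae_eq_def AE_half_line_iff elim: eventually_mono)
  have "M (\<lambda>x. F x - T n x) = M (\<lambda>x. T n x - G x)" for n
    using V.N_ae[OF V.diff_mem[OF T G(1)] ae_eq_diff[OF ae_eq_refl eq]] V.N_diff_commute[OF F T] by simp
  then show ?thesis using G(2) by (simp add: T_def)
qed

end

subsection \<open>Orbits of the unit shifts\<close>

lemma cinner_self_real: "Re (cinner x x) = (norm (x::'h::chilbert_space))\<^sup>2"
  by (simp add: cinner_self)

lemma cinner_add_right: "cinner (x::'h::chilbert_space) (y + z) = cinner x y + cinner x z"
  by (metis cinner_add_left cinner_commute complex_cnj_add)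

lemma cinner_scaleR_left: "cinner (r *\<^sub>R x) (y::'h::chilbert_space) = complex_of_real r * cinner x y"
  by (metis cinner_scaleC_left scaleC_of_real)

lemma cinner_scaleR_right: "cinner (x::'h::chilbert_space) (r *\<^sub>R y) = complex_of_real r * cinner x y"
  by (metis cinner_commute cinner_scaleR_left complex_cnj_complex_of_real complex_cnj_mult)

text \<open>Subtracting the real multiple \<open>t e\<close> from \<open>x\<close> leaves a vector
  of squared norm \<open>|x|^2 - t^2\<close>, which is nonnegative.\<close>

lemma abs_Re_cinner_le:
  assumes "norm (e::'h::chilbert_space) = 1"
  shows "\<bar>Re (cinner x e)\<bar> \<le> norm x"
proof -
  define t where "t = Re (cinner x e)"
  have "Re (cinner e x) = t"
    unfolding t_def by (subst cinner_commute) simp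
  then have "Re (cinner (x + (- t) *\<^sub>R e) (x + (- t) *\<^sub>R e)) = (norm x)\<^sup>2 - t\<^sup>2"
    unfolding cinner_add_left cinner_add_right cinner_scaleR_left cinner_scaleR_right
    using assms by (simp add: t_def[symmetric] cinner_self_real power2_eq_square algebra_simps)
  then have "t\<^sup>2 \<le> (norm x)\<^sup>2"
    unfolding cinner_self_real using zero_le_power2[of "norm (x + (- t) *\<^sub>R e)"] by linarith
  then show ?thesis
    unfolding t_def by (simp add: abs_le_square_iff[symmetric])
qed

text \<open>On [0, 1[ the translated term is 0, so r g = f there, and positivity spreads to the
  right along the orbit. Then f \<le> r g, and the value of \<open>g\<close> one step to the left is
  at most r g; iteration gives the second claim.\<close>

lemma right_shift_orbit:
  fixes f g :: "real \<Rightarrow> real"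
  assumes r: "0 < r" and f: "\<And>y. 0 \<le> f y"
    and eq: "\<And>j::int. 0 \<le> x + real_of_int j \<Longrightarrow> r * g (x + real_of_int j) = f (x + real_of_int j) + translation 1 g (x + real_of_int j)"
    and "0 \<le> x + real_of_int j"
  shows "0 \<le> g (x + real_of_int j)" "translation (real k) f (x + real_of_int j) \<le> r ^ Suc k * g (x + real_of_int j)"
proof -
  have nonneg: "0 \<le> g (x + real_of_int j)" if "0 \<le> x + real_of_int j" "x + real_of_int j < real n" for n j
    using that
  proof (induction n arbitrary: j)
    case (Suc n)
    have "0 \<le> translation 1 g (x + real_of_int j)"
      using Suc.IH[of "j - 1"] Suc.prems by (auto simp: translation_def algebra_simps)
    then have "0 \<le> r * g (x + real_of_int j)"
      using eq[of j] f Suc.prems by simp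
    then show ?case using r by (simp add: zero_le_mult_iff)
  qed simp
  have nonneg': "0 \<le> g (x + real_of_int j)" if "0 \<le> x + real_of_int j" for j
    using nonneg[OF that] reals_Archimedean2 by blast
  then show "0 \<le> g (x + real_of_int j)" using assms by blast
  show "translation (real k) f (x + real_of_int j) \<le> r ^ Suc k * g (x + real_of_int j)"
    using assms(4)
  proof (induction k arbitrary: j)
    case 0
    have "0 \<le> translation 1 g (x + real_of_int j)"
      using nonneg'[of "j - 1"] by (auto simp: translation_def algebra_simps)
    then show ?case using eq[of j] 0 by (simp add: translation_def)
  next
    case (Suc k)
    show ?case
    proof (cases "real (Suc k) \<le> x + real_of_int j")
      case True
      then have 1: "0 \<le> x + real_of_int (j - 1)" by simp
      have "translation (real (Suc k)) f (x + real_of_int j) = translation (real k) f (x + real_of_int (j - 1))"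
        using True by (simp add: translation_def algebra_simps)
      also have "\<dots> \<le> r ^ Suc k * g (x + real_of_int (j - 1))"
        by (rule Suc.IH[OF 1])
      also have "g (x + real_of_int (j - 1)) \<le> r * g (x + real_of_int j)"
        using eq[of j] f[of "x + real_of_int j"] Suc.prems 1 by (simp add: translation_def algebra_simps)
      then have "r ^ Suc k * g (x + real_of_int (j - 1)) \<le> r ^ Suc k * (r * g (x + real_of_int j))"
        using r by (intro mult_left_mono) auto
      finally show ?thesis by (simp add: mult_ac)
    next
      case False
      then show ?thesis using nonneg'[OF Suc.prems] r by (simp add: translation_def)
    qed
  qed
qed

text \<open>The recursion is read from the far end: beyond \<open>n\<close> the solution is 0, and
  positivity spreads to the left. The induction runs over the number \<open>m\<close> of unit steps
  that suffice to reach \<open>n\<close>.\<close>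

lemma left_shift_orbit:
  fixes f g :: "real \<Rightarrow> real"
  assumes r: "0 < r" and f: "\<And>y. 0 \<le> f y"
    and eq: "\<And>j::int. 0 \<le> x + real_of_int j \<Longrightarrow> r * g (x + real_of_int j) = f (x + real_of_int j) + translation (-1) g (x + real_of_int j)"
    and vanish: "\<And>j::int. real n \<le> x + real_of_int j \<Longrightarrow> g (x + real_of_int j) = 0"
    and "0 \<le> x + real_of_int j"
  shows "0 \<le> g (x + real_of_int j)" "translation (- real k) f (x + real_of_int j) \<le> r ^ Suc k * g (x + real_of_int j)"
proof -
  have eq': "r * g (x + real_of_int j) = f (x + real_of_int j) + g (x + real_of_int (j + 1))" if "0 \<le> x + real_of_int j" for j
    using eq[OF that] that by (simp add: translation_def add.assoc)
  have nonneg: "0 \<le> g (x + real_of_int j)" if "0 \<le> x + real_of_int j" "real n \<le> x + real_of_int j + real m" for m j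
    using that
  proof (induction m arbitrary: j)
    case 0
    then show ?case using vanish[of j] by simp
  next
    case (Suc m)
    have "0 \<le> g (x + real_of_int (j + 1))"
      using Suc.IH[of "j + 1"] Suc.prems by (simp add: algebra_simps)
    then have "0 \<le> r * g (x + real_of_int j)"
      using eq'[OF Suc.prems(1)] f[of "x + real_of_int j"] by simp
    then show ?case using r by (simp add: zero_le_mult_iff)
  qed
  have nonneg': "0 \<le> g (x + real_of_int j)" if "0 \<le> x + real_of_int j" for j
    using nonneg[OF that, of n] that by simp
  then show "0 \<le> g (x + real_of_int j)" using assms by blast
  show "translation (- real k) f (x + real_of_int j) \<le> r ^ Suc k * g (x + real_of_int j)"
    using assms(5)
  proof (induction k arbitrary: j)
    case 0
    then show ?case using eq'[of j] nonneg'[of "j + 1"] by (simp add: translation_def)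
  next
    case (Suc k)
    then have 1: "0 \<le> x + real_of_int (j + 1)" by simp
    have "translation (- real (Suc k)) f (x + real_of_int j) = translation (- real k) f (x + real_of_int (j + 1))"
      using Suc.prems by (simp add: translation_def algebra_simps)
    also have "\<dots> \<le> r ^ Suc k * g (x + real_of_int (j + 1))"
      by (rule Suc.IH[OF 1])
    also have "g (x + real_of_int (j + 1)) \<le> r * g (x + real_of_int j)"
      using eq'[OF Suc.prems] f[of "x + real_of_int j"] by simp
    then have "r ^ Suc k * g (x + real_of_int (j + 1)) \<le> r ^ Suc k * (r * g (x + real_of_int j))"
      using r by (intro mult_left_mono) auto
    finally show ?case by (simp add: mult_ac)
  qed
qed

lemma right_shift_power: "0 \<le> x \<Longrightarrow> (translation 1 ^^ k) F x = translation (real k) F x"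
  by (induction k arbitrary: x) (auto simp: translation_def algebra_simps)

text \<open>At negative arguments the two sides can differ, since the iterated shift is cut off at
  each step.\<close>

lemma left_shift_power: "0 \<le> x \<Longrightarrow> (translation (-1) ^^ k) F x = translation (- real k) F x"
  by (induction k arbitrary: x) (auto simp: translation_def algebra_simps)

lemma AE_half_line_ex:
  assumes "AE x in lebesgue_on {0..}. P (x::real)"
  shows "\<exists>x. 0 \<le> x \<and> x \<le> 1/2 \<and> P x"
proof (rule ccontr)
  assume no: "\<not> ?thesis"
  obtain S where S: "negligible S" "{x. \<not> (0 \<le> x \<longrightarrow> P x)} \<subseteq> S"
    using assms unfolding AE_half_line_iff eventually_ae_filter_negligible by blast
  then have "negligible (cbox 0 (1/2 :: real))"
    using no by (intro negligible_subset[OF S(1)]) auto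
  then show False unfolding negligible_interval by simp
qed

context half_line_space
begin

subsection \<open>Spectra of the unit shifts\<close>

definition rotate :: "real \<Rightarrow> (real \<Rightarrow> 'h) \<Rightarrow> real \<Rightarrow> 'h"
  where "rotate \<theta> F x = cis (\<theta> * x) *\<^sub>C F x"

lemma rotate_mem:
  assumes "F \<in> V" shows "rotate \<theta> F \<in> V" "M (rotate \<theta> F) = M F"
proof -
  have "(\<lambda>x. cis (\<theta> * x)) \<in> borel_measurable lborel"
    by (auto intro!: borel_measurable_continuous_onI continuous_intros)
  then have "(\<lambda>x. cis (\<theta> * x)) \<in> borel_measurable (lebesgue_on {0..})"
    by (intro measurable_restrict_space1 measurable_completion)
  from scaleC_measurable[OF this V.measurable[OF assms]]
  have "rotate \<theta> F \<in> borel_measurable (lebesgue_on {0..})"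
    by (simp add: rotate_def[abs_def])
  then show "rotate \<theta> F \<in> V" "M (rotate \<theta> F) = M F"
    using V_same_norm[OF assms] by (simp_all add: rotate_def)
qed

lemma rotate_translation:
  "translation a (rotate \<theta> F) x - (cis (- \<theta> * a) * z) *\<^sub>C rotate \<theta> F x
    = cis (- \<theta> * a) *\<^sub>C rotate \<theta> (\<lambda>x. translation a F x - z *\<^sub>C F x) x"
proof -
  have "translation a (rotate \<theta> F) x = cis (- \<theta> * a) *\<^sub>C rotate \<theta> (translation a F) x"
    by (simp add: translation_def rotate_def scaleC_scaleC cis_mult algebra_simps)
  then show ?thesis
    by (simp add: rotate_def scaleC_diff_right scaleC_scaleC mult_ac)
qed

text \<open>Conjugation by \<open>rotate\<close> is isometric, so the same \<open>C\<close> serves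
  on the whole circle; the width of the annulus found later rests on this. As
  \<open>a \<noteq> 0\<close>, a suitable \<open>\<theta>\<close> produces any prescribed
  argument.\<close>

lemma invertible_rotate:
  assumes inv: "V.invertible_at (translation a) z C" and "a \<noteq> 0" "cmod w = cmod z"
  shows "V.invertible_at (translation a) w C"
proof -
  obtain \<theta> where w: "w = cis (- \<theta> * a) * z"
  proof (cases "z = 0")
    case False
    then have "w / z \<noteq> 0" "cmod (w / z) = 1"
      using assms by (auto simp: norm_divide)
    then have "cis (Arg (w / z)) = w / z"
      by (simp add: cis_Arg sgn_eq)
    then show ?thesis
      using that[of "- Arg (w / z) / a"] False assms by (simp add: field_simps)
  qed (use that assms in auto)
  have inverse: "rotate \<theta> (rotate (- \<theta>) F) = F" for F
    by (auto simp: rotate_def scaleC_scaleC cis_mult)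
  have rotate_ae: "ae_eq (rotate \<theta> F) (rotate \<theta> G)" if "ae_eq F G" for \<theta> F G
    using that unfolding ae_eq_def rotate_def by (auto elim: eventually_mono)
  show ?thesis
    unfolding V.invertible_at_def
  proof (intro conjI ballI impI)
    show "0 \<le> C" using inv by (simp add: V.invertible_at_def)
    fix F assume F: "F \<in> V"
    \<comment> \<open>The right-hand side is rotated back beforehand, so that the factors from
      \<open>rotate_translation\<close> cancel.\<close>
    define F' where "F' = (\<lambda>x. cis (\<theta> * a) *\<^sub>C rotate (- \<theta>) F x)"
    have F': "F' \<in> V" "M F' = M F"
      unfolding F'_def using rotate_mem[OF F] by (simp_all add: V.scaleC_mem V.N_scaleC)
    obtain G where G: "G \<in> V" "ae_eq (\<lambda>x. translation a G x - z *\<^sub>C G x) F'" "M G \<le> C * M F'"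
      using V.invertible_at_solve[OF inv F'(1)] .
    have "ae_eq (\<lambda>x. translation a (rotate \<theta> G) x - w *\<^sub>C rotate \<theta> G x) (\<lambda>x. cis (- \<theta> * a) *\<^sub>C rotate \<theta> F' x)"
      unfolding w rotate_translation by (intro ae_eq_scaleC rotate_ae G)
    also have "(\<lambda>x. cis (- \<theta> * a) *\<^sub>C rotate \<theta> F' x) = F"
      by (auto simp: F'_def rotate_def scaleC_scaleC cis_mult)
    finally show "\<exists>G\<in>V. ae_eq (\<lambda>x. translation a G x - w *\<^sub>C G x) F \<and> M G \<le> C * M F"
      using G F' rotate_mem[OF G(1)] by (intro bexI[of _ "rotate \<theta> G"]) auto
  next
    fix G assume G: "G \<in> V" "ae_eq (\<lambda>x. translation a G x - w *\<^sub>C G x) (\<lambda>x. 0)"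
    define G' where "G' = rotate (- \<theta>) G"
    have G': "G' \<in> V" "rotate \<theta> G' = G"
      using rotate_mem(1)[OF G(1)] inverse by (simp_all add: G'_def)
    have "AE x in lebesgue_on {0..}. cis (- \<theta> * a) *\<^sub>C rotate \<theta> (\<lambda>x. translation a G' x - z *\<^sub>C G' x) x = 0"
      using G(2) unfolding ae_eq_def w G'(2)[symmetric] rotate_translation .
    then have "ae_eq (\<lambda>x. translation a G' x - z *\<^sub>C G' x) (\<lambda>x. 0)"
      unfolding ae_eq_def
    proof (rule eventually_mono)
      fix x assume "cis (- \<theta> * a) *\<^sub>C rotate \<theta> (\<lambda>x. translation a G' x - z *\<^sub>C G' x) x = 0"
      then have "norm (cis (- \<theta> * a) *\<^sub>C rotate \<theta> (\<lambda>x. translation a G' x - z *\<^sub>C G' x) x) = 0"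
        by simp
      then show "translation a G' x - z *\<^sub>C G' x = 0"
        unfolding rotate_def norm_scaleC by simp
    qed
    then have "ae_eq G' (\<lambda>x. 0)"
      using inv G'(1) unfolding V.invertible_at_def by blast
    from rotate_ae[OF this, of \<theta>] show "ae_eq G (\<lambda>x. 0)"
      unfolding G'(2) by (simp add: rotate_def[abs_def])
  qed
qed

section \<open>Positive solutions and bounds on powers\<close>

text \<open>The right-hand sides solved for below point in the direction \<open>e\<close>, so this
  coordinate of a solution obeys a real scalar equation; it is dominated by the pointwise
  norm.\<close>

definition coord :: "(real \<Rightarrow> 'h) \<Rightarrow> real \<Rightarrow> real"
  where "coord G x = Re (cinner (G x) e)"

lemma coord_le: "coord G x \<le> norm (G x)"
  using abs_Re_cinner_le[OF norm_e, of "G x"] by (simp add: coord_def)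

lemma coord_zero: "G x = 0 \<Longrightarrow> coord G x = 0"
  using cinner_scaleR_left[of 0 e e] by (simp add: coord_def)

text \<open>With a positive right-hand side \<open>f\<close>, the coordinate \<open>g\<close> of the solution satisfies
  \<open>r g = f + A g\<close>. Along almost every orbit this gives \<open>g \<ge> 0\<close> and hence \<open>A\<^sup>k f \<le> r\<^sup>k\<^sup>+\<^sup>1 g\<close>.\<close>

lemma positive_solution:
  assumes inv: "V.invertible_at (translation a) (complex_of_real r) C" and F: "F \<in> V"
  shows "\<exists>G\<in>V. M G \<le> C * M F \<and>
    ae_eq (\<lambda>x. translation a G x - complex_of_real r *\<^sub>C G x) (\<lambda>x. - (norm (F x) *\<^sub>R e)) \<and>
    (AE x in lebesgue_on {0..}. r * coord G x = norm (F x) + translation a (coord G) x)"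
proof -
  \<comment> \<open>The minus sign turns \<open>A G - r G = F'\<close> into
    \<open>r G = |F| e + A G\<close>.\<close>
  define F' where "F' = (\<lambda>x. - (norm (F x) *\<^sub>R e))"
  have lift: "(\<lambda>x. norm (F x) *\<^sub>R e) \<in> V" "M (\<lambda>x. norm (F x) *\<^sub>R e) = M F"
    using lift_mem[OF V_memD[OF F]] by (simp_all add: vec_norm_def)
  have F': "F' \<in> V" "M F' = M F"
    unfolding F'_def using V.minus_mem[OF lift(1)] V.N_minus[OF lift(1)] lift(2) by auto
  obtain G where G: "G \<in> V" "ae_eq (\<lambda>x. translation a G x - complex_of_real r *\<^sub>C G x) F'" "M G \<le> C * M F'"
    using V.invertible_at_solve[OF inv F'(1)] .
  have "AE x in lebesgue_on {0..}. r * coord G x = norm (F x) + translation a (coord G) x"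
    using G(2) unfolding ae_eq_def
  proof (rule eventually_mono)
    fix x assume "translation a G x - complex_of_real r *\<^sub>C G x = F' x"
    then have "r *\<^sub>R G x = norm (F x) *\<^sub>R e + translation a G x"
      by (simp add: F'_def scaleC_of_real algebra_simps)
    then have "Re (cinner (r *\<^sub>R G x) e) = Re (cinner (norm (F x) *\<^sub>R e + translation a G x) e)"
      by (rule arg_cong)
    moreover have "Re (cinner (translation a G x) e) = translation a (coord G) x"
      using cinner_scaleR_left[of 0 e e] by (simp add: translation_def coord_def)
    ultimately show "r * coord G x = norm (F x) + translation a (coord G) x"
      using cinner_self_real[of e] norm_e by (simp add: cinner_scaleR_left cinner_add_left coord_def)
  qed
  then show ?thesis
    using G F'(2) unfolding F'_def by auto
qed

lemma power_bound_from_domination: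
  assumes F: "F \<in> V" and G: "G \<in> V" "M G \<le> C * M F" and s: "0 \<le> s"
    and dom: "AE x in lebesgue_on {0..}. norm (translation t F x) \<le> s * norm (G x)"
  shows "M (translation t F) \<le> s * (C * M F)"
proof -
  have "M (translation t F) \<le> M (\<lambda>x. complex_of_real s *\<^sub>C G x)"
    using dom s by (intro solid(2)[OF V.scaleC_mem[OF G(1)]] translation_measurable V.measurable[OF F]) simp
  also have "\<dots> = s * M G" using V.N_scaleC[OF G(1)] s by simp
  also have "\<dots> \<le> s * (C * M F)" using G(2) s by (rule mult_left_mono)
  finally show ?thesis .
qed

lemma right_shift_power_bound:
  assumes inv: "V.invertible_at (translation 1) (complex_of_real r) C" and r: "0 < r" and F: "F \<in> V"
  shows "M ((translation 1 ^^ k) F) \<le> C * r * r ^ k * M F"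
proof -
  obtain G where G: "G \<in> V" "M G \<le> C * M F"
    and g: "AE x in lebesgue_on {0..}. r * coord G x = norm (F x) + translation 1 (coord G) x"
    using positive_solution[OF inv F] by blast
  have "AE x in lebesgue_on {0..}. norm (translation (real k) F x) \<le> r ^ Suc k * norm (G x)"
    using AE_half_line_orbit[OF g] unfolding AE_half_line_iff
  proof (rule eventually_mono, intro impI)
    fix x :: real
    assume orbit: "0 \<le> x \<longrightarrow> (\<forall>j::int. 0 \<le> x + j \<longrightarrow> r * coord G (x + j) = norm (F (x + j)) + translation 1 (coord G) (x + j))"
      and x: "0 \<le> x"
    have "translation (real k) (\<lambda>x. norm (F x)) (x + real_of_int 0) \<le> r ^ Suc k * coord G (x + real_of_int 0)"
      using orbit x by (intro right_shift_orbit(2)[OF r, where f = "\<lambda>x. norm (F x)"]) auto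
    moreover have "r ^ Suc k * coord G x \<le> r ^ Suc k * norm (G x)"
      using r coord_le by (intro mult_left_mono) auto
    ultimately show "norm (translation (real k) F x) \<le> r ^ Suc k * norm (G x)"
      unfolding norm_translation by simp
  qed
  then have "M (translation (real k) F) \<le> r ^ Suc k * (C * M F)"
    using power_bound_from_domination[OF F G] r by simp
  moreover have "M ((translation 1 ^^ k) F) = M (translation (real k) F)"
  proof (rule V.N_ae)
    show "translation (real k) F \<in> V" using V_translation V.op_mem F by blast
  qed (simp add: ae_eqI right_shift_power)
  ultimately show ?thesis
    by (simp add: mult_ac)
qed

text \<open>Left translation by \<open>n\<close> removes the right-hand side, which vanishes beyond
  \<open>n\<close>. It commutes with the shift, so \<open>G'\<close> solves the homogeneous equation
  and is 0 by injectivity. Thus \<open>G\<close> vanishes beyond \<open>n\<close>, as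
  \<open>left_shift_orbit\<close> requires.\<close>

lemma left_shift_power_bound_compact:
  assumes inv: "V.invertible_at (translation (-1)) (complex_of_real r) C" and r: "0 < r" and F: "F \<in> V"
    and supp: "\<And>x. real n \<le> x \<Longrightarrow> F x = 0"
  shows "M (translation (- real k) F) \<le> r ^ Suc k * (C * M F)"
proof -
  obtain G where G: "G \<in> V" "M G \<le> C * M F"
      "ae_eq (\<lambda>x. translation (-1) G x - complex_of_real r *\<^sub>C G x) (\<lambda>x. - (norm (F x) *\<^sub>R e))"
    and g: "AE x in lebesgue_on {0..}. r * coord G x = norm (F x) + translation (-1) (coord G) x"
    using positive_solution[OF inv F] by blast
  define G' where "G' = translation (- real n) G"
  have "G' \<in> V"
    using V_translation V.op_mem G(1) unfolding G'_def by blast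
  moreover have "ae_eq (\<lambda>x. translation (-1) G' x - complex_of_real r *\<^sub>C G' x) (\<lambda>x. 0)"
  proof -
    have "ae_eq (\<lambda>x. translation (-1) G' x - complex_of_real r *\<^sub>C G' x)
      (translation (- real n) (\<lambda>x. translation (-1) G x - complex_of_real r *\<^sub>C G x))"
      by (rule ae_eqI) (simp add: G'_def translation_def algebra_simps)
    also have "ae_eq \<dots> (translation (- real n) (\<lambda>x. - (norm (F x) *\<^sub>R e)))"
      by (rule ae_eq_translation[OF G(3)])
    also have "ae_eq \<dots> (\<lambda>x. 0)"
      by (rule ae_eqI) (simp add: translation_def supp)
    finally show ?thesis .
  qed
  ultimately have "ae_eq G' (\<lambda>x. 0)"
    using inv unfolding V.invertible_at_def by blast
  then have "AE x in lebesgue_on {0..}. 0 \<le> x + (- real n) \<longrightarrow> G' (x + (- real n)) = 0"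
    unfolding ae_eq_def by (rule AE_half_line_translate)
  then have "AE x in lebesgue_on {0..}. r * coord G x = norm (F x) + translation (-1) (coord G) x \<and> (real n \<le> x \<longrightarrow> coord G x = 0)"
    using g
  proof (rule eventually_elim2)
    fix x assume *: "0 \<le> x + (- real n) \<longrightarrow> G' (x + (- real n)) = 0"
      and "r * coord G x = norm (F x) + translation (-1) (coord G) x"
    moreover have "coord G x = 0" if "real n \<le> x"
      using * that by (intro coord_zero) (simp add: G'_def translation_def)
    ultimately show "r * coord G x = norm (F x) + translation (-1) (coord G) x \<and> (real n \<le> x \<longrightarrow> coord G x = 0)"
      by blast
  qed
  from AE_half_line_orbit[OF this]
  have "AE x in lebesgue_on {0..}. norm (translation (- real k) F x) \<le> r ^ Suc k * norm (G x)"
    unfolding AE_half_line_iff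
  proof (rule eventually_mono, intro impI)
    fix x :: real
    assume orbit: "0 \<le> x \<longrightarrow> (\<forall>j::int. 0 \<le> x + j \<longrightarrow>
        r * coord G (x + j) = norm (F (x + j)) + translation (-1) (coord G) (x + j) \<and> (real n \<le> x + j \<longrightarrow> coord G (x + j) = 0))"
      and x: "0 \<le> x"
    have "translation (- real k) (\<lambda>x. norm (F x)) (x + real_of_int 0) \<le> r ^ Suc k * coord G (x + real_of_int 0)"
    proof (rule left_shift_orbit(2)[OF r, where f = "\<lambda>x. norm (F x)" and n = n])
      show "coord G (x + real_of_int j) = 0" if "real n \<le> x + real_of_int j" for j
        using orbit x that order_trans[OF of_nat_0_le_iff that] by blast
    qed (use orbit x in auto)
    moreover have "r ^ Suc k * coord G x \<le> r ^ Suc k * norm (G x)"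
      using r coord_le by (intro mult_left_mono) auto
    ultimately show "norm (translation (- real k) F x) \<le> r ^ Suc k * norm (G x)"
      unfolding norm_translation by simp
  qed
  then show ?thesis
    using power_bound_from_domination[OF F G(1,2)] r by simp
qed

text \<open>The bound for truncations does not depend on \<open>n\<close>. For fixed
  \<open>k\<close> the translation is bounded, with a \<open>c\<close> that may depend on
  \<open>k\<close>, so the error disappears in the limit.\<close>

lemma left_shift_power_bound:
  assumes inv: "V.invertible_at (translation (-1)) (complex_of_real r) C" and r: "0 < r" and F: "F \<in> V"
  shows "M ((translation (-1) ^^ k) F) \<le> C * r * r ^ k * M F"
proof -
  define T where "T n = (\<lambda>x. indicator {0..<real n} x *\<^sub>R F x)" for n
  have T: "T n \<in> V" "M (T n) \<le> M F" for n
    unfolding T_def using truncation_mem[OF F] by blast+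
  have C: "0 \<le> C" using inv by (simp add: V.invertible_at_def)
  obtain c where c: "V.bounded_by (translation (- real k)) c"
    using V_translation by blast
  have "M (translation (- real k) F) \<le> r ^ Suc k * (C * M F) + c * M (\<lambda>x. F x - T n x)" for n
  proof -
    have "M (translation (- real k) (T n)) \<le> r ^ Suc k * (C * M (T n))"
      by (rule left_shift_power_bound_compact[OF inv r T(1), of n]) (simp add: T_def)
    also have "\<dots> \<le> r ^ Suc k * (C * M F)"
      using r C T(2) by (intro mult_left_mono) auto
    finally show ?thesis
      using V.N_le_diff[OF V.op_mem[OF c F] V.op_mem[OF c T(1)[of n]]] V.op_diff_bound[OF c F T(1)[of n]]
      by linarith
  qed
  moreover have "(\<lambda>n. r ^ Suc k * (C * M F) + c * M (\<lambda>x. F x - T n x)) \<longlonglongrightarrow> r ^ Suc k * (C * M F) + c * 0"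
    unfolding T_def by (intro tendsto_intros truncation_tendsto F)
  ultimately have "M (translation (- real k) F) \<le> r ^ Suc k * (C * M F)"
    by (intro LIMSEQ_le_const) auto
  moreover have "M ((translation (-1) ^^ k) F) = M (translation (- real k) F)"
    by (intro V.N_ae V.op_mem[OF c F] ae_eqI) (simp add: left_shift_power)
  ultimately show ?thesis
    by (simp add: mult_ac)
qed

section \<open>Zero belongs to both spectra\<close>

text \<open>It serves twice: the left shift annihilates it, and it lies outside the range of the
  right shift, whose members vanish on [0, 1[.\<close>

definition unit_block :: "real \<Rightarrow> 'h"
  where "unit_block x = indicator {0..1/2} x *\<^sub>R e"

lemma unit_block: "unit_block \<in> V" "\<not> ae_eq unit_block (\<lambda>x. 0)"
proof -
  show "unit_block \<in> V"
    unfolding unit_block_def[abs_def] by (rule lift_mem(1)[OF indicator_mem]) simp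
  show "\<not> ae_eq unit_block (\<lambda>x. 0)"
  proof
    assume "ae_eq unit_block (\<lambda>x. 0)"
    then obtain x where "0 \<le> x" "x \<le> 1/2" "unit_block x = 0"
      using AE_half_line_ex[of "\<lambda>x. unit_block x = 0"] unfolding ae_eq_def by blast
    then show False using norm_e by (auto simp: unit_block_def)
  qed
qed

lemma zero_in_right_spectrum: "0 \<in> op_spectrum V M (translation 1)"
proof (rule ccontr)
  assume "0 \<notin> op_spectrum V M (translation 1)"
  then obtain C where inv: "V.invertible_at (translation 1) 0 C"
    using V_translation V.not_in_spectrumE by metis
  obtain G where "ae_eq (\<lambda>x. translation 1 G x - 0 *\<^sub>C G x) unit_block"
    using V.invertible_at_solve[OF inv unit_block(1)] by blast
  then obtain x where "0 \<le> x" "x \<le> 1/2" "translation 1 G x - 0 *\<^sub>C G x = unit_block x"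
    using AE_half_line_ex[of "\<lambda>x. translation 1 G x - 0 *\<^sub>C G x = unit_block x"] unfolding ae_eq_def by blast
  then show False using norm_e by (auto simp: unit_block_def translation_def)
qed

lemma zero_in_left_spectrum: "0 \<in> op_spectrum V M (translation (-1))"
proof (rule ccontr)
  assume "0 \<notin> op_spectrum V M (translation (-1))"
  then obtain C where inv: "V.invertible_at (translation (-1)) 0 C"
    using V_translation V.not_in_spectrumE by metis
  have "ae_eq (\<lambda>x. translation (-1) unit_block x - 0 *\<^sub>C unit_block x) (\<lambda>x. 0)"
    by (rule ae_eqI) (simp add: unit_block_def translation_def)
  then show False
    using inv unit_block unfolding V.invertible_at_def by blast
qed

section \<open>Both spectra are closed discs\<close>

text \<open>Strictness places the points on the circle of spectral radius in the spectrum; it comes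
  from the gap \<open>\<epsilon>\<close>. The assumption \<open>zero\<close> excludes r = 0 and
  makes the supremum one over a nonempty set.\<close>

lemma spectral_radius_less:
  assumes a: "a \<noteq> 0" and zero: "0 \<in> op_spectrum V M (translation a)"
    and powers: "\<And>r C F k. V.invertible_at (translation a) (complex_of_real r) C \<Longrightarrow> 0 < r \<Longrightarrow> F \<in> V \<Longrightarrow>
      M ((translation a ^^ k) F) \<le> C * r * r ^ k * M F"
    and z: "z \<notin> op_spectrum V M (translation a)"
  shows "op_spectral_radius V M (translation a) < cmod z"
proof -
  obtain c where c: "V.bounded_by (translation a) c" using V_translation by blast
  obtain C where inv: "V.invertible_at (translation a) z C" using V.not_in_spectrumE[OF z c] .
  have C: "0 \<le> C" using inv by (simp add: V.invertible_at_def)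
  define r where "r = cmod z"
  have r: "0 < r" using z zero unfolding r_def by auto
  \<comment> \<open>The second entry yields \<open>\<epsilon> * C < 1\<close> for
    \<open>invertible_at_open\<close>, also when C = 0; the first keeps \<open>w\<close> away from
    0.\<close>
  define \<epsilon> where "\<epsilon> = min r (1 / (C + 1))"
  have \<epsilon>: "0 < \<epsilon>" "\<epsilon> \<le> r" "\<epsilon> * C < 1"
  proof -
    show "0 < \<epsilon>" "\<epsilon> \<le> r" using r C by (auto simp: \<epsilon>_def)
    have "\<epsilon> * C \<le> 1 / (C + 1) * C" using C by (intro mult_right_mono) (auto simp: \<epsilon>_def)
    also have "\<dots> < 1" using C by simp
    finally show "\<epsilon> * C < 1" .
  qed
  have inv_r: "V.invertible_at (translation a) w C" if "cmod w = r" for w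
    using invertible_rotate[OF inv a] that by (simp add: r_def)
  have "cmod w \<le> r - \<epsilon>" if w: "w \<in> op_spectrum V M (translation a)" for w
  proof (rule ccontr)
    assume "\<not> cmod w \<le> r - \<epsilon>"
    then have less: "r - \<epsilon> < cmod w" by simp
    then have w0: "0 < cmod w" using \<epsilon> by linarith
    have "\<exists>C'. V.invertible_at (translation a) w C'"
    proof (cases "r < cmod w")
      case True
      then show ?thesis
        using r C powers[OF inv_r[of "complex_of_real r"]] by (intro V.invertible_at_large[OF c, of "C * r" r]) auto
    next
      case False
      \<comment> \<open>Radial projection of \<open>w\<close> to the circle on which the bound
        \<open>C\<close> holds.\<close>
      define w' where "w' = complex_of_real (r / cmod w) * w"
      have "cmod w' = r" using w0 r by (simp add: w'_def norm_mult norm_divide)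
      moreover have "w - w' = complex_of_real (1 - r / cmod w) * w"
        by (simp add: w'_def algebra_simps)
      then have "cmod (w - w') = \<bar>1 - r / cmod w\<bar> * cmod w"
        by (simp only: norm_mult norm_of_real)
      then have "cmod (w - w') = r - cmod w"
        using False w0 by (simp add: abs_if field_simps)
      then have "cmod (w - w') * C \<le> \<epsilon> * C"
        using less C by (intro mult_right_mono) auto
      then have "cmod (w - w') * C < 1" using \<epsilon>(3) by linarith
      ultimately show ?thesis
        using V.invertible_at_open[OF inv_r c, of w' w] by blast
    qed
    then show False using w V.not_in_spectrumI[OF _ c] by blast
  qed
  then have "op_spectral_radius V M (translation a) \<le> r - \<epsilon>"
    unfolding op_spectral_radius_def using zero by (intro cSUP_least) auto
  then show ?thesis using \<epsilon> by (simp add: r_def)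
qed

lemma right_spectrum:
  "z \<in> op_spectrum V M (translation 1) \<longleftrightarrow> cmod z \<le> op_spectral_radius V M (translation 1)"
proof
  assume "z \<in> op_spectrum V M (translation 1)"
  then show "cmod z \<le> op_spectral_radius V M (translation 1)"
    using V_translation V.cmod_le_spectral_radius by blast
next
  assume le: "cmod z \<le> op_spectral_radius V M (translation 1)"
  show "z \<in> op_spectrum V M (translation 1)"
  proof (rule ccontr)
    assume "z \<notin> op_spectrum V M (translation 1)"
    then have "op_spectral_radius V M (translation 1) < cmod z"
      by (intro spectral_radius_less zero_in_right_spectrum right_shift_power_bound) auto
    then show False using le by simp
  qed
qed

lemma left_spectrum:
  "z \<in> op_spectrum V M (translation (-1)) \<longleftrightarrow> cmod z \<le> op_spectral_radius V M (translation (-1))"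
proof
  assume "z \<in> op_spectrum V M (translation (-1))"
  then show "cmod z \<le> op_spectral_radius V M (translation (-1))"
    using V_translation V.cmod_le_spectral_radius by blast
next
  assume le: "cmod z \<le> op_spectral_radius V M (translation (-1))"
  show "z \<in> op_spectrum V M (translation (-1))"
  proof (rule ccontr)
    assume "z \<notin> op_spectrum V M (translation (-1))"
    then have "op_spectral_radius V M (translation (-1)) < cmod z"
      by (intro spectral_radius_less zero_in_left_spectrum left_shift_power_bound) auto
    then show False using le by simp
  qed
qed

text \<open>Since \<open>S\<^sub>-\<^sub>k S\<^sub>k\<close> is the identity, the powers of \<open>S\<^sub>-\<^sub>1\<close> cannot decay faster than every geometric
  sequence.\<close>

lemma left_spectral_radius_pos: "0 < op_spectral_radius V M (translation (-1))"
proof (rule ccontr)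
  assume not_pos: "\<not> 0 < op_spectral_radius V M (translation (-1))"
  obtain c where c: "V.bounded_by (translation 1) c" using V_translation by blast
  have c0: "0 \<le> c" by (rule V.op_bound_nonneg[OF c])
  obtain c' where c': "V.bounded_by (translation (-1)) c'" using V_translation by blast
  \<comment> \<open>Here \<open>c\<close> bounds the right shift, and \<open>r * c \<le> 1/2\<close>
    lets the decay r^k for the left shift beat the growth c^k of the right one.\<close>
  define r where "r = 1 / (2 * (c + 1))"
  have r: "0 < r" using c0 by (simp add: r_def)
  have "r * c = (1/2) * (c / (c + 1))" by (simp add: r_def)
  also have "\<dots> \<le> (1/2) * 1" using c0 by (intro mult_left_mono) auto
  finally have rc: "r * c \<le> 1/2" by simp
  have "complex_of_real r \<notin> op_spectrum V M (translation (-1))"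
    using not_pos r by (simp add: left_spectrum)
  then obtain C where inv: "V.invertible_at (translation (-1)) (complex_of_real r) C"
    using V.not_in_spectrumE[OF _ c'] by blast
  have C: "0 \<le> C" using inv by (simp add: V.invertible_at_def)
  let ?F = unit_block
  have "M ?F \<le> C * r * M ?F * (1/2) ^ k" for k
  proof -
    let ?G = "(translation 1 ^^ k) ?F"
    have G: "?G \<in> V" by (rule V.op_power_mem[OF c unit_block(1)])
    have "ae_eq ?F ((translation (-1) ^^ k) ?G)"
      by (rule ae_eqI) (simp add: left_shift_power right_shift_power translation_def)
    from V.N_ae[OF unit_block(1) this] have "M ?F = M ((translation (-1) ^^ k) ?G)" ..
    also have "\<dots> \<le> C * r * r ^ k * M ?G"
      by (rule left_shift_power_bound[OF inv r G])
    also have "\<dots> \<le> C * r * r ^ k * (c ^ k * M ?F)"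
      using C r by (intro mult_left_mono V.op_power_bound[OF c unit_block(1)]) auto
    also have "\<dots> = C * r * M ?F * (r * c) ^ k"
      by (simp add: power_mult_distrib)
    also have "\<dots> \<le> C * r * M ?F * (1/2) ^ k"
      using C r c0 rc V.N_nonneg[OF unit_block(1)] by (intro mult_left_mono power_mono) auto
    finally show ?thesis .
  qed
  moreover have "(\<lambda>k. C * r * M ?F * (1/2) ^ k) \<longlonglongrightarrow> C * r * M ?F * 0"
    by (intro tendsto_intros LIMSEQ_power_zero) auto
  ultimately have "M ?F \<le> 0"
    by (intro LIMSEQ_le_const) auto
  then show False
    using V.N_le_0_imp[OF unit_block(1)] unit_block(2) by blast
qed

end

theorem theorem4:
  fixes E :: "(real \<Rightarrow> complex) set"
    and N :: "(real \<Rightarrow> complex) \<Rightarrow> real"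
    and Ebar :: "(real \<Rightarrow> 'h::{chilbert_space, second_countable_topology}) set"
    and Nbar :: "(real \<Rightarrow> 'h) \<Rightarrow> real"
  assumes H_nonzero: "\<exists>h::'h. h \<noteq> 0"
    and E_banach: "banach_function_space E N"
    and H1: "hyp_H1 E N"
    and H2: "hyp_H2 E N"
    and H3: "hyp_H3 E N"
    and Ebar_eq: "Ebar = vec_space E"
    and Nbar_eq: "Nbar = vec_norm N"
    and Ebar_banach: "banach_function_space Ebar Nbar"
  shows "op_spectrum Ebar Nbar (translation 1) \<inter>
      {1 / z | z. z \<in> op_spectrum Ebar Nbar (translation (-1)) \<and> z \<noteq> 0} =
    {z. 1 / op_spectral_radius Ebar Nbar (translation (-1)) \<le> cmod z \<and>
        cmod z \<le> op_spectral_radius Ebar Nbar (translation 1)}"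
proof -
  obtain h :: 'h where h: "h \<noteq> 0" using H_nonzero by blast
  interpret half_line_space E N "(1 / norm h) *\<^sub>R h"
    using E_banach H1 H2 H3 Ebar_banach h unfolding Ebar_eq Nbar_eq by unfold_locales auto
  let ?\<rho> = "op_spectral_radius (vec_space E :: (real \<Rightarrow> 'h) set) (vec_norm N) (translation (-1))"
  \<comment> \<open>Positivity of \<open>?\<rho>\<close> makes \<open>1 / ?\<rho>\<close> positive,
    so the right-hand inequality excludes z = 0, which is not the inverse of any nonzero
    point.\<close>
  have inverse: "(\<exists>w. z = 1 / w \<and> cmod w \<le> ?\<rho> \<and> w \<noteq> 0) \<longleftrightarrow> 1 / ?\<rho> \<le> cmod z" for z
  proof
    assume "\<exists>w. z = 1 / w \<and> cmod w \<le> ?\<rho> \<and> w \<noteq> 0"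
    then show "1 / ?\<rho> \<le> cmod z"
      using left_spectral_radius_pos by (auto simp: norm_divide intro!: frac_le)
  next
    assume *: "1 / ?\<rho> \<le> cmod z"
    then have "0 < cmod z"
      using left_spectral_radius_pos by (smt (verit) divide_pos_pos)
    then show "\<exists>w. z = 1 / w \<and> cmod w \<le> ?\<rho> \<and> w \<noteq> 0"
      using * left_spectral_radius_pos
      by (intro exI[of _ "1 / z"]) (auto simp: norm_divide field_simps)
  qed
  show ?thesis
    unfolding Ebar_eq Nbar_eq using inverse by (auto simp: right_spectrum left_spectrum)
qed

end
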